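(* Let $U\subset\mathbb{C}^d$ be a connected open set, and let $L:U\times U^*\to\mathbb{C}$ be a hermitian kernel. Assume that $L$ is rational of the form $$L(\tau,\overline{\sigma})=\frac{\langle p_1(\tau),p_1(\sigma)\rangle-\langle p_2(\tau),p_2(\sigma)\rangle}{q(\tau)\overline{q(\sigma)}-\langle r(\tau),r(\sigma)\rangle},$$ where the numerator $P(\tau,\overline{\sigma})=\langle p_1(\tau),p_1(\sigma)\rangle-\langle p_2(\tau),p_2(\sigma)\rangle$ is a hermitian polynomial, with $p_j:\mathbb{C}^d\to K_j$ $(j=1,2)$ polynomial maps with values in finite dimensional Hilbert spaces $K_j$, $q(\tau)$ is a polynomial, and $r(\tau)\in K_3$ is a polynomial map with values in a finite dimensional Hilbert space $K_3$, such that $|q(\tau)|>\|r(\tau)\|$ for $\tau\in U$. The kernel $L$ is positive semi-definite on $U\times U^*$ if and only if there exist an auxiliary Hilbert space $K$ and a linear isometric transform $$\begin{pmatrix}A&B\\ C&D\end{pmatrix}:(K_3\otimes K)\oplus K_1\longrightarrow K\oplus K_2$$ with the property $$L(\tau,\overline{\sigma})=\big\langle[q(\tau)I-A(r(\tau)\otimes I)]^{-1}Bp_1(\tau),\,[q(\sigma)I-A(r(\sigma)\otimes I)]^{-1}Bp_1(\sigma)\big\rangle,\qquad\tau,\sigma\in U.$$ Moreover, $$p_2(\tau)=C\big[r(\tau)\otimes(q(\tau)I-A(r(\tau)\otimes I))^{-1}Bp_1(\tau)\big]+Dp_1(\tau),\qquad\tau\in U.$$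
   Context: $U^*=\{\overline{\sigma}:\sigma\in U\}$. The symbol $\otimes$ denotes the completed Hilbert space tensor product in case $\dim K=\infty$. If $\dim K<\infty$, the space $K_2$ may be enlarged by a direct summand, so that the dimension of the domain of the isometry does not exceed that of its codomain. For $\tau\in U$, $r(\tau)\otimes I:K\to K_3\otimes K$ is the map $x\mapsto r(\tau)\otimes x$, so $q(\tau)I-A(r(\tau)\otimes I)$ is an operator on $K$. The kernel $L$ is positive semi-definite if $\sum_{k,\ell}L(\tau_k,\overline{\tau_\ell})c_k\overline{c_\ell}\ge0$ for all finite families $\tau_k\in U$, $c_k\in\mathbb{C}$. *)

theory Defs
  imports "HOL-Analysis.Analysis" "HOL-Algebra.Algebraic_Closure_Type"
begin

section \<open>Complex Hilbert spaces with explicit carriers\<close>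

text \<open>
  Carriers are explicit so that one can quantify existentially over Hilbert spaces.  The fields
  \<open>mult\<close> and \<open>one\<close> inherited from the record of rings play no role, as for any HOL-Algebra module.
\<close>

record 'a inner_module = "(complex, 'a) module" +
  cinner :: "'a \<Rightarrow> 'a \<Rightarrow> complex"

abbreviation complex_scalars :: "complex ring" where
  "complex_scalars \<equiv> ring_of_type_algebra"

definition hnorm :: "('a, 'm) inner_module_scheme \<Rightarrow> 'a \<Rightarrow> real" where
  "hnorm H x = sqrt (Re (cinner H x x))"

text \<open>The inner product is linear in the first and conjugate linear in the second argument.\<close>

locale complex_hilbert_space = module complex_scalars H
  for H :: "('a, 'm) inner_module_scheme" (structure) +
  assumes cinner_add_left:
      "\<lbrakk>x \<in> carrier H; y \<in> carrier H; z \<in> carrier H\<rbrakk>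
        \<Longrightarrow> cinner H (x \<oplus>\<^bsub>H\<^esub> y) z = cinner H x z + cinner H y z"
    and cinner_smult_left:
      "\<lbrakk>x \<in> carrier H; z \<in> carrier H\<rbrakk> \<Longrightarrow> cinner H (c \<odot>\<^bsub>H\<^esub> x) z = c * cinner H x z"
    and cinner_commute:
      "\<lbrakk>x \<in> carrier H; y \<in> carrier H\<rbrakk> \<Longrightarrow> cinner H x y = cnj (cinner H y x)"
    and cinner_nonneg: "x \<in> carrier H \<Longrightarrow> 0 \<le> Re (cinner H x x)"
    and cinner_definite: "\<lbrakk>x \<in> carrier H; cinner H x x = 0\<rbrakk> \<Longrightarrow> x = \<zero>\<^bsub>H\<^esub>"
    and complete:
      "\<lbrakk>\<And>n::nat. s n \<in> carrier H;
        \<And>\<epsilon>. 0 < \<epsilon> \<Longrightarrow> \<exists>N. \<forall>m\<ge>N. \<forall>n\<ge>N. hnorm H (s m \<ominus>\<^bsub>H\<^esub> s n) < \<epsilon>\<rbrakk>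
        \<Longrightarrow> \<exists>x\<in>carrier H. (\<lambda>n. hnorm H (s n \<ominus>\<^bsub>H\<^esub> x)) \<longlonglongrightarrow> 0"

definition finite_dimensional :: "('a, 'm) inner_module_scheme \<Rightarrow> bool" where
  "finite_dimensional H \<longleftrightarrow>
    (\<exists>B. finite B \<and> B \<subseteq> carrier H \<and>
      (\<forall>x\<in>carrier H. \<exists>c. x = (\<Oplus>\<^bsub>H\<^esub>b\<in>B. c b \<odot>\<^bsub>H\<^esub> b)))"

definition hilbert_sum :: "'a inner_module \<Rightarrow> 'b inner_module \<Rightarrow> ('a \<times> 'b) inner_module" where
  "hilbert_sum H G =
    \<lparr>carrier = carrier H \<times> carrier G,
     mult = (\<lambda>(x, y) (x', y'). (x \<otimes>\<^bsub>H\<^esub> x', y \<otimes>\<^bsub>G\<^esub> y')),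
     one = (\<one>\<^bsub>H\<^esub>, \<one>\<^bsub>G\<^esub>),
     zero = (\<zero>\<^bsub>H\<^esub>, \<zero>\<^bsub>G\<^esub>),
     add = (\<lambda>(x, y) (x', y'). (x \<oplus>\<^bsub>H\<^esub> x', y \<oplus>\<^bsub>G\<^esub> y')),
     smult = (\<lambda>c (x, y). (c \<odot>\<^bsub>H\<^esub> x, c \<odot>\<^bsub>G\<^esub> y)),
     cinner = (\<lambda>(x, y) (x', y'). cinner H x x' + cinner G y y')\<rparr>"

text \<open>
  \<open>T\<close> with elementary tensors \<open>tens x y\<close> is a completed Hilbert space tensor product of \<open>H\<close> and \<open>G\<close>,
  that is, a completion of the algebraic tensor product for the inner product with
  \<open>\<langle>x \<otimes> y, x' \<otimes> y'\<rangle> = \<langle>x, x'\<rangle> \<langle>y, y'\<rangle>\<close>.  This determines \<open>(T, tens)\<close> up to a unique unitary operator.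
\<close>

definition is_hilbert_tensor ::
    "'a inner_module \<Rightarrow> 'b inner_module \<Rightarrow> 'c inner_module \<Rightarrow> ('a \<Rightarrow> 'b \<Rightarrow> 'c) \<Rightarrow> bool" where
  "is_hilbert_tensor H G T tens \<longleftrightarrow>
    complex_hilbert_space T \<and>
    (\<forall>x\<in>carrier H. \<forall>y\<in>carrier G. tens x y \<in> carrier T) \<and>
    (\<forall>x\<in>carrier H. \<forall>x'\<in>carrier H. \<forall>y\<in>carrier G.
      tens (x \<oplus>\<^bsub>H\<^esub> x') y = tens x y \<oplus>\<^bsub>T\<^esub> tens x' y) \<and>
    (\<forall>x\<in>carrier H. \<forall>y\<in>carrier G. \<forall>y'\<in>carrier G.
      tens x (y \<oplus>\<^bsub>G\<^esub> y') = tens x y \<oplus>\<^bsub>T\<^esub> tens x y') \<and>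
    (\<forall>c. \<forall>x\<in>carrier H. \<forall>y\<in>carrier G.
      tens (c \<odot>\<^bsub>H\<^esub> x) y = c \<odot>\<^bsub>T\<^esub> tens x y \<and> tens x (c \<odot>\<^bsub>G\<^esub> y) = c \<odot>\<^bsub>T\<^esub> tens x y) \<and>
    (\<forall>x\<in>carrier H. \<forall>x'\<in>carrier H. \<forall>y\<in>carrier G. \<forall>y'\<in>carrier G.
      cinner T (tens x y) (tens x' y') = cinner H x x' * cinner G y y') \<and>
    (\<forall>t\<in>carrier T. \<forall>\<epsilon>>0. \<exists>(n::nat) a b.
      (\<forall>i<n. a i \<in> carrier H \<and> b i \<in> carrier G) \<and>
      hnorm T (t \<ominus>\<^bsub>T\<^esub> (\<Oplus>\<^bsub>T\<^esub>i\<in>{..<n}. tens (a i) (b i))) < \<epsilon>)"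


section \<open>Linear operators\<close>

definition linear_operator :: "'a inner_module \<Rightarrow> 'b inner_module \<Rightarrow> ('a \<Rightarrow> 'b) \<Rightarrow> bool" where
  "linear_operator H G f \<longleftrightarrow>
    f \<in> carrier H \<rightarrow> carrier G \<and>
    (\<forall>x\<in>carrier H. \<forall>y\<in>carrier H. f (x \<oplus>\<^bsub>H\<^esub> y) = f x \<oplus>\<^bsub>G\<^esub> f y) \<and>
    (\<forall>c. \<forall>x\<in>carrier H. f (c \<odot>\<^bsub>H\<^esub> x) = c \<odot>\<^bsub>G\<^esub> f x)"

definition linear_isometry :: "'a inner_module \<Rightarrow> 'b inner_module \<Rightarrow> ('a \<Rightarrow> 'b) \<Rightarrow> bool" where
  "linear_isometry H G f \<longleftrightarrow>
    linear_operator H G f \<and> (\<forall>x\<in>carrier H. hnorm G (f x) = hnorm H x)"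

definition isometric_block_matrix ::
    "'a inner_module \<Rightarrow> 'b inner_module \<Rightarrow> 'c inner_module \<Rightarrow> 'e inner_module \<Rightarrow>
      ('a \<Rightarrow> 'c) \<Rightarrow> ('b \<Rightarrow> 'c) \<Rightarrow> ('a \<Rightarrow> 'e) \<Rightarrow> ('b \<Rightarrow> 'e) \<Rightarrow> bool" where
  "isometric_block_matrix H1 H2 G1 G2 A B C D \<longleftrightarrow>
    linear_operator H1 G1 A \<and> linear_operator H2 G1 B \<and>
    linear_operator H1 G2 C \<and> linear_operator H2 G2 D \<and>
    linear_isometry (hilbert_sum H1 H2) (hilbert_sum G1 G2)
      (\<lambda>(x, y). (A x \<oplus>\<^bsub>G1\<^esub> B y, C x \<oplus>\<^bsub>G2\<^esub> D y))"

text \<open>For a scalar \<open>c\<close> and a vector \<open>u\<close>, the operator \<open>c I - A (u \<otimes> I)\<close> on \<open>K\<close>.\<close>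

definition pencil ::
    "'a inner_module \<Rightarrow> ('b \<Rightarrow> 'a \<Rightarrow> 'c) \<Rightarrow> ('c \<Rightarrow> 'a) \<Rightarrow> complex \<Rightarrow> 'b \<Rightarrow> 'a \<Rightarrow> 'a" where
  "pencil K tens A c u = (\<lambda>x. c \<odot>\<^bsub>K\<^esub> x \<ominus>\<^bsub>K\<^esub> A (tens u x))"

definition invertible_on :: "'a inner_module \<Rightarrow> ('a \<Rightarrow> 'a) \<Rightarrow> bool" where
  "invertible_on K S \<longleftrightarrow> bij_betw S (carrier K) (carrier K)"

abbreviation inverse_on :: "'a inner_module \<Rightarrow> ('a \<Rightarrow> 'a) \<Rightarrow> 'a \<Rightarrow> 'a" where
  "inverse_on K S \<equiv> inv_into (carrier K) S"


section \<open>Polynomial maps\<close>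

definition monomial_at :: "('d::finite \<Rightarrow> nat) \<Rightarrow> complex^'d \<Rightarrow> complex" where
  "monomial_at \<alpha> \<tau> = (\<Prod>i\<in>UNIV. \<tau> $ i ^ \<alpha> i)"

definition polynomial_fun :: "(complex^'d::finite \<Rightarrow> complex) \<Rightarrow> bool" where
  "polynomial_fun f \<longleftrightarrow>
    (\<exists>F c. finite F \<and> (\<forall>\<tau>. f \<tau> = (\<Sum>\<alpha>\<in>F. monomial_at \<alpha> \<tau> * c \<alpha>)))"

definition polynomial_map :: "'a inner_module \<Rightarrow> (complex^'d::finite \<Rightarrow> 'a) \<Rightarrow> bool" where
  "polynomial_map H f \<longleftrightarrow>
    (\<exists>F c. finite F \<and> (\<forall>\<alpha>\<in>F. c \<alpha> \<in> carrier H) \<and>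
      (\<forall>\<tau>. f \<tau> = (\<Oplus>\<^bsub>H\<^esub>\<alpha>\<in>F. monomial_at \<alpha> \<tau> \<odot>\<^bsub>H\<^esub> c \<alpha>)))"


section \<open>Kernels on \<open>U \<times> U\<^sup>*\<close>\<close>

definition vec_cnj :: "complex^'d \<Rightarrow> complex^'d" where
  "vec_cnj \<sigma> = (\<chi> i. cnj (\<sigma> $ i))"

text \<open>
  A kernel is a function of \<open>(\<tau>, \<omega>)\<close> with \<open>\<omega> \<in> U\<^sup>*\<close>, so that its second argument is always of
  the form \<open>vec_cnj \<sigma>\<close> with \<open>\<sigma> \<in> U\<close>; values elsewhere are irrelevant.
\<close>

definition hermitian_kernel ::
    "(complex^'d) set \<Rightarrow> (complex^'d \<Rightarrow> complex^'d \<Rightarrow> complex) \<Rightarrow> bool" where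
  "hermitian_kernel U L \<longleftrightarrow>
    (\<forall>\<tau>\<in>U. \<forall>\<sigma>\<in>U. L \<tau> (vec_cnj \<sigma>) = cnj (L \<sigma> (vec_cnj \<tau>)))"

definition positive_semidefinite_kernel ::
    "(complex^'d) set \<Rightarrow> (complex^'d \<Rightarrow> complex^'d \<Rightarrow> complex) \<Rightarrow> bool" where
  "positive_semidefinite_kernel U L \<longleftrightarrow>
    (\<forall>(n::nat) \<tau> c. (\<forall>k<n. \<tau> k \<in> U) \<longrightarrow>
      (\<Sum>k<n. \<Sum>l<n. L (\<tau> k) (vec_cnj (\<tau> l)) * c k * cnj (c l)) \<in> \<real>\<^sub>\<ge>\<^sub>0)"


section \<open>Transfer function realizations\<close>

text \<open>
  \<open>T\<close> with \<open>tens\<close> plays the role of \<open>K3 \<otimes> K\<close>, and \<open>E\<close> is the summand by which \<open>K2\<close> may be enlarged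
  when \<open>K\<close> is finite dimensional.
\<close>

definition isometric_colligation ::
    "'k1 inner_module \<Rightarrow> 'k2 inner_module \<Rightarrow> 'k3 inner_module \<Rightarrow>
      'k inner_module \<Rightarrow> 't inner_module \<Rightarrow> ('k3 \<Rightarrow> 'k \<Rightarrow> 't) \<Rightarrow> 'e inner_module \<Rightarrow>
      ('t \<Rightarrow> 'k) \<Rightarrow> ('k1 \<Rightarrow> 'k) \<Rightarrow> ('t \<Rightarrow> 'k2 \<times> 'e) \<Rightarrow> ('k1 \<Rightarrow> 'k2 \<times> 'e) \<Rightarrow> bool" where
  "isometric_colligation K1 K2 K3 K T tens E A B C D \<longleftrightarrow>
    complex_hilbert_space K \<and>
    is_hilbert_tensor K3 K T tens \<and>
    complex_hilbert_space E \<and> finite_dimensional E \<and>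
    (\<not> finite_dimensional K \<longrightarrow> carrier E = {\<zero>\<^bsub>E\<^esub>}) \<and>
    isometric_block_matrix T K1 K (hilbert_sum K2 E) A B C D"

text \<open>The vector \<open>(q(\<tau>) I - A (r(\<tau>) \<otimes> I))\<^sup>-\<^sup>1 B p1(\<tau>)\<close>.\<close>

definition state_map ::
    "'k inner_module \<Rightarrow> ('k3 \<Rightarrow> 'k \<Rightarrow> 't) \<Rightarrow> ('t \<Rightarrow> 'k) \<Rightarrow> ('k1 \<Rightarrow> 'k) \<Rightarrow>
      ('z \<Rightarrow> complex) \<Rightarrow> ('z \<Rightarrow> 'k3) \<Rightarrow> ('z \<Rightarrow> 'k1) \<Rightarrow> 'z \<Rightarrow> 'k" where
  "state_map K tens A B q r p1 \<tau> = inverse_on K (pencil K tens A (q \<tau>) (r \<tau>)) (B (p1 \<tau>))"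

definition realizes_kernel ::
    "(complex^'d) set \<Rightarrow> (complex^'d \<Rightarrow> complex^'d \<Rightarrow> complex) \<Rightarrow>
      'k inner_module \<Rightarrow> ('k3 \<Rightarrow> 'k \<Rightarrow> 't) \<Rightarrow> ('t \<Rightarrow> 'k) \<Rightarrow> ('k1 \<Rightarrow> 'k) \<Rightarrow>
      (complex^'d \<Rightarrow> complex) \<Rightarrow> (complex^'d \<Rightarrow> 'k3) \<Rightarrow> (complex^'d \<Rightarrow> 'k1) \<Rightarrow> bool" where
  "realizes_kernel U L K tens A B q r p1 \<longleftrightarrow>
    (\<forall>\<tau>\<in>U. invertible_on K (pencil K tens A (q \<tau>) (r \<tau>))) \<and>
    (\<forall>\<tau>\<in>U. \<forall>\<sigma>\<in>U.
      L \<tau> (vec_cnj \<sigma>) =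
        cinner K (state_map K tens A B q r p1 \<tau>) (state_map K tens A B q r p1 \<sigma>))"

end

theory Submission
  imports Defs "HOL-Analysis.Urysohn"
begin

text \<open>
  If \<open>L\<close> is positive, factor it as \<open>L(\<tau>, \<sigma>\<^sup>*) = \<langle>k(\<tau>), k(\<sigma>)\<rangle>\<close>.  Clearing the denominator gives
  \<open>\<langle>r(\<tau>) \<otimes> k(\<tau>), r(\<sigma>) \<otimes> k(\<sigma>)\<rangle> + \<langle>p1(\<tau>), p1(\<sigma>)\<rangle> = \<langle>q(\<tau>) k(\<tau>), q(\<sigma>) k(\<sigma>)\<rangle> + \<langle>p2(\<tau>), p2(\<sigma>)\<rangle>\<close>,
  so \<open>(r(\<tau>) \<otimes> k(\<tau>), p1(\<tau>)) \<mapsto> (q(\<tau>) k(\<tau>), p2(\<tau>))\<close> extends to an isometry with blocks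
  \<open>A, B, C, D\<close>.  The first component of this relation is
  \<open>(q(\<tau>) I - A (r(\<tau>) \<otimes> I)) k(\<tau>) = B p1(\<tau>)\<close>, where the operator on the left is invertible since
  \<open>A\<close> is a contraction and \<open>\<parallel>r(\<tau>)\<parallel> < \<bar>q(\<tau>)\<bar>\<close>; the second is the formula for \<open>p2\<close>.

  The state space is always taken to be an infinite dimensional sequence space in which the \<open>k(\<tau>)\<close>
  leave infinitely many coordinates free, so that the isometry extends to the whole space and
  \<open>K2\<close> need not be enlarged.  Both the factorization and the extension rest on Gram--Schmidt
  orthogonalization in terms of kernels: subtracting \<open>G(i, p) G(p, j) / G(p, p)\<close> from a positive kernel
  \<open>G\<close> leaves a positive kernel that vanishes at \<open>p\<close>, and doing so along a dense sequence of points
  produces the coordinates of a factorization.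
\<close>

section \<open>Schur complements of positive kernels\<close>

text \<open>The isometry is prescribed on a family of vectors only, and extending it would normally
  call for closed spans, a check that the linear map is well defined, and orthogonal projections.
  Kernel coordinates bypass all three: they are computed from the Gram matrix alone, so two families
  with equal Gram matrices have literally equal coordinates, and one coordinate map followed by the
  adjoint of the other is the desired partial isometry. The price is that pivots form a sequence,
  while \<open>U\<close> is uncountable. Continuity closes this gap: the residual diagonal entry at
  a point is at most the squared distance to any pivot already used, so pivots dense in
  \<open>U\<close> exhaust every point. The kernels are continuous because Cauchy-Schwarz and the
  bound on the norm of \<open>r\<close> keep the denominator nonzero off the diagonal as
  well.\<close>

definition psd_on :: "'i set \<Rightarrow> ('i \<Rightarrow> 'i \<Rightarrow> complex) \<Rightarrow> bool" where
  "psd_on I G \<longleftrightarrow>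
    (\<forall>i\<in>I. \<forall>j\<in>I. G i j = cnj (G j i)) \<and>
    (\<forall>(n::nat) t c. (\<forall>k<n. t k \<in> I) \<longrightarrow>
      0 \<le> Re (\<Sum>k<n. \<Sum>l<n. G (t k) (t l) * c k * cnj (c l)))"

text \<open>For a Gram kernel this is the Gram kernel of the components orthogonal to the vector of
  \<open>p\<close>, written without mentioning vectors.\<close>

definition schur_step :: "('i \<Rightarrow> 'i \<Rightarrow> complex) \<Rightarrow> 'i \<Rightarrow> 'i \<Rightarrow> 'i \<Rightarrow> complex" where
  "schur_step G p i j = G i j - G i p * G p j / G p p"

fun schur :: "('i \<Rightarrow> 'i \<Rightarrow> complex) \<Rightarrow> (nat \<Rightarrow> 'i) \<Rightarrow> nat \<Rightarrow> 'i \<Rightarrow> 'i \<Rightarrow> complex" where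
  "schur G p 0 = G"
| "schur G p (Suc n) = schur_step (schur G p n) (p n)"

text \<open>When the pivot is degenerate (zero diagonal entry), \<open>x / 0 = 0\<close> makes the step the identity and
  the coordinate \<open>0\<close>, so linearly dependent pivots are harmless.\<close>

definition schur_coord :: "('i \<Rightarrow> 'i \<Rightarrow> complex) \<Rightarrow> (nat \<Rightarrow> 'i) \<Rightarrow> 'i \<Rightarrow> nat \<Rightarrow> complex" where
  "schur_coord G p i n =
    schur G p n i (p n) / complex_of_real (sqrt (Re (schur G p n (p n) (p n))))"

lemma psd_on_herm: "psd_on I G \<Longrightarrow> i \<in> I \<Longrightarrow> j \<in> I \<Longrightarrow> G i j = cnj (G j i)"
  unfolding psd_on_def by blast

lemma psd_on_form:
  fixes n :: nat
  shows "psd_on I G \<Longrightarrow> (\<And>k. k < n \<Longrightarrow> t k \<in> I) \<Longrightarrow>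
    0 \<le> Re (\<Sum>k<n. \<Sum>l<n. G (t k) (t l) * c k * cnj (c l))"
  unfolding psd_on_def by blast

lemma psd_on_diag:
  assumes "psd_on I G" "i \<in> I"
  shows "0 \<le> Re (G i i)" "G i i = complex_of_real (Re (G i i))"
proof -
  have "0 \<le> Re (\<Sum>k<1::nat. \<Sum>l<1::nat. G ((\<lambda>_. i) k) ((\<lambda>_. i) l) * (\<lambda>_. 1) k * cnj ((\<lambda>_. 1) l))"
    by (rule psd_on_form[OF assms(1)]) (simp add: assms(2))
  then show "0 \<le> Re (G i i)" by simp
  show "G i i = complex_of_real (Re (G i i))"
    using arg_cong[OF psd_on_herm[OF assms(1,2,2)], of Im] by (simp add: complex_eq_iff)
qed

text \<open>Appending \<open>p\<close> with a free coefficient \<open>a\<close> to a family turns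
  positivity into a quadratic inequality in \<open>a\<close>. The degenerate and the regular pivot
  both follow by choosing \<open>a\<close>.\<close>

lemma psd_on_extend:
  fixes n :: nat and t :: "nat \<Rightarrow> 'i" and c :: "nat \<Rightarrow> complex"
  assumes G: "psd_on I G" and p: "p \<in> I" and t: "\<forall>k<n. t k \<in> I"
  defines "s \<equiv> \<Sum>k<n. G (t k) p * c k"
  shows "0 \<le> Re (\<Sum>k<n. \<Sum>l<n. G (t k) (t l) * c k * cnj (c l))
              + 2 * Re (cnj a * s) + (cmod a)\<^sup>2 * Re (G p p)"
proof -
  define t' where "t' = (\<lambda>k. if k < n then t k else p)"
  define c' where "c' = (\<lambda>k. if k < n then c k else a)"
  have "0 \<le> Re (\<Sum>k<Suc n. \<Sum>l<Suc n. G (t' k) (t' l) * c' k * cnj (c' l))"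
  proof -
    have "\<forall>k<Suc n. t' k \<in> I" using t p by (simp add: t'_def)
    then show ?thesis using G unfolding psd_on_def by blast
  qed
  also have "(\<Sum>k<Suc n. \<Sum>l<Suc n. G (t' k) (t' l) * c' k * cnj (c' l)) =
     (\<Sum>k<n. \<Sum>l<n. G (t k) (t l) * c k * cnj (c l)) + (\<Sum>k<n. G (t k) p * c k * cnj a)
      + ((\<Sum>l<n. G p (t l) * a * cnj (c l)) + G p p * a * cnj a)"
    by (simp add: sum.distrib t'_def c'_def)
  also have "(\<Sum>k<n. G (t k) p * c k * cnj a) = cnj a * s"
    by (simp add: s_def sum_distrib_left mult_ac)
  also have "(\<Sum>l<n. G p (t l) * a * cnj (c l)) = cnj (cnj a * s)"
    by (simp add: s_def sum_distrib_left mult_ac psd_on_herm[OF G p] t)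
  also have "G p p * a * cnj a = complex_of_real ((cmod a)\<^sup>2 * Re (G p p))"
    unfolding of_real_mult complex_norm_square psd_on_diag(2)[OF G p, symmetric] by (simp only: mult_ac)
  finally show ?thesis by simp
qed

text \<open>With no quadratic term, the inequality of \<open>psd_on_extend\<close> is affine in
  \<open>a\<close>, and an affine function bounded below is constant.\<close>

lemma psd_on_zero_diag:
  assumes G: "psd_on I G" and p: "p \<in> I" and i: "i \<in> I" and 0: "Re (G p p) = 0"
  shows "G i p = 0" "G p i = 0"
proof -
  define s where "s = G i p"
  have *: "0 \<le> Re (G i i) + 2 * Re (cnj a * s)" for a
    using psd_on_extend[OF G p, of 1 "\<lambda>_. i" "\<lambda>_. 1" a] i 0 by (simp add: s_def)
  have "s = 0"
  proof (rule ccontr)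
    assume "s \<noteq> 0"
    \<comment> \<open>Chosen so that the linear term becomes \<open>- 2 * (Re (G i i) + 1)\<close>,
      which outweighs the constant term \<open>Re (G i i)\<close>.\<close>
    define r where "r = - (Re (G i i) + 1) / (cmod s)\<^sup>2"
    have "Re (cnj (complex_of_real r * s) * s) = r * (cmod s)\<^sup>2"
      by (simp only: cmod_power2) (simp add: power2_eq_square algebra_simps)
    also have "\<dots> = - (Re (G i i) + 1)" using \<open>s \<noteq> 0\<close> by (simp add: r_def)
    finally show False using *[of "complex_of_real r * s"] psd_on_diag(1)[OF G i] by simp
  qed
  then show "G i p = 0" by (simp add: s_def)
  then show "G p i = 0" using psd_on_herm[OF G p i] by simp
qed

text \<open>The form of the Schur complement is the minimum over \<open>a\<close> of the quadratic
  in \<open>psd_on_extend\<close>, attained at \<open>a = - s / g\<close>. For \<open>g = 0\<close>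
  the division by zero leaves the original form.\<close>

lemma psd_on_schur_step:
  fixes p :: 'i
  assumes G: "psd_on I G" and p: "p \<in> I"
  shows "psd_on I (schur_step G p)"
proof -
  define g where "g = Re (G p p)"
  have gp: "G p p = complex_of_real g" "0 \<le> g"
    using psd_on_diag[OF G p] by (simp_all add: g_def)
  show ?thesis unfolding psd_on_def
  proof (intro conjI ballI allI impI)
    fix i j assume ij: "i \<in> I" "j \<in> I"
    show "schur_step G p i j = cnj (schur_step G p j i)"
      unfolding schur_step_def
      using psd_on_herm[OF G ij] psd_on_herm[OF G ij(1) p] psd_on_herm[OF G p ij(2)]
      by (simp add: gp mult.commute)
  next
    fix n :: nat and t :: "nat \<Rightarrow> 'i" and c :: "nat \<Rightarrow> complex"
    assume t: "\<forall>k<n. t k \<in> I"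
    define s where "s = (\<Sum>k<n. G (t k) p * c k)"
    define Q where "Q = (\<Sum>k<n. \<Sum>l<n. G (t k) (t l) * c k * cnj (c l))"
    have s': "cnj s = (\<Sum>l<n. G p (t l) * cnj (c l))"
      by (simp add: s_def psd_on_herm[OF G p] t)
    have "s * cnj s / G p p = (\<Sum>k<n. \<Sum>l<n. G (t k) p * c k * (G p (t l) * cnj (c l)) / G p p)"
      unfolding s' unfolding s_def sum_product sum_divide_distrib ..
    then have "(\<Sum>k<n. \<Sum>l<n. schur_step G p (t k) (t l) * c k * cnj (c l)) =
        Q - s * cnj s / G p p"
      by (simp add: schur_step_def Q_def algebra_simps sum_subtractf)
    also have "s * cnj s / G p p = complex_of_real ((cmod s)\<^sup>2 / g)"
      unfolding gp(1) of_real_divide complex_norm_square ..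
    finally have eq: "Re (\<Sum>k<n. \<Sum>l<n. schur_step G p (t k) (t l) * c k * cnj (c l)) = Re Q - (cmod s)\<^sup>2 / g"
      by simp
    show "0 \<le> Re (\<Sum>k<n. \<Sum>l<n. schur_step G p (t k) (t l) * c k * cnj (c l))"
    proof (cases "g = 0")
      case True
      have "0 \<le> Re Q" using G t unfolding psd_on_def Q_def by blast
      then show ?thesis using eq True by simp
    next
      case False
      have "0 \<le> Re Q + 2 * Re (cnj (- s / g) * s) + (cmod (- s / g))\<^sup>2 * g"
        using psd_on_extend[OF G p t, of c "- s / g"] by (simp add: s_def Q_def g_def)
      also have "Re (cnj (- s / g) * s) = - (cmod s)\<^sup>2 / g"
      proof -
        have "cnj (- s / g) * s = complex_of_real (- (cmod s)\<^sup>2 / g)"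
          unfolding of_real_divide of_real_minus complex_norm_square by simp
        then show ?thesis by (simp only: Re_complex_of_real)
      qed
      also have "(cmod (- s / g))\<^sup>2 * g = (cmod s)\<^sup>2 / g"
        using False gp(2) by (simp add: norm_divide power_divide power2_eq_square)
      finally show ?thesis using eq by simp
    qed
  qed
qed

text \<open>This is nonnegativity of the diagonal of the Schur complement at \<open>j\<close>, with
  the denominator cleared.\<close>

lemma psd_on_Cauchy_Schwarz:
  assumes G: "psd_on I G" and i: "i \<in> I" and j: "j \<in> I"
  shows "(cmod (G i j))\<^sup>2 \<le> Re (G i i) * Re (G j j)"
proof (cases "Re (G j j) = 0")
  case True then show ?thesis using psd_on_zero_diag[OF G j i] by simp
next
  case False
  have "0 \<le> Re (schur_step G j i i)"
    using psd_on_diag(1)[OF psd_on_schur_step[OF G j] i] .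
  also have "schur_step G j i i = G i i - complex_of_real ((cmod (G i j))\<^sup>2 / Re (G j j))"
    unfolding schur_step_def of_real_divide complex_norm_square psd_on_diag(2)[OF G j, symmetric]
      psd_on_herm[OF G j i] ..
  finally have "(cmod (G i j))\<^sup>2 / Re (G j j) \<le> Re (G i i)" by simp
  moreover have "0 < Re (G j j)" using False psd_on_diag(1)[OF G j] by simp
  ultimately show ?thesis by (simp add: field_simps)
qed

text \<open>The squared distance between the vectors of \<open>i\<close> and \<open>j\<close> in any
  factorization of \<open>G\<close>. It expresses density of pivots before any factorization
  exists.\<close>

definition kernel_dist2 :: "('i \<Rightarrow> 'i \<Rightarrow> complex) \<Rightarrow> 'i \<Rightarrow> 'i \<Rightarrow> real" where
  "kernel_dist2 G i j = Re (G i i + G j j - G i j - G j i)"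

lemma kernel_dist2_same [simp]: "kernel_dist2 G t t = 0"
  by (simp add: kernel_dist2_def)

section \<open>Gram-Schmidt along a sequence of pivots\<close>

locale pivoted_kernel =
  fixes I :: "'i set" and G :: "'i \<Rightarrow> 'i \<Rightarrow> complex" and p :: "nat \<Rightarrow> 'i"
  assumes psd: "psd_on I G" and pivot_in [simp, intro]: "p n \<in> I"
begin

lemma psd_on_schur:
  "psd_on I (schur G p n)"
  by (induction n) (auto simp: psd psd_on_schur_step)

text \<open>The step at \<open>p k\<close> clears the row and column of \<open>p k\<close>, and
  later steps subtract products that contain an entry already cleared.\<close>

lemma schur_pivot:
  assumes i: "i \<in> I" and "k < n"
  shows "schur G p n i (p k) = 0" "schur G p n (p k) i = 0"
proof -
  have *: "schur G p n i (p k) = 0" if "i \<in> I" for i using \<open>k < n\<close> that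
  proof (induction n arbitrary: i)
    case (Suc n)
    note psdn = psd_on_schur[of n]
    show ?case
    proof (cases "k = n")
      case True
      \<comment> \<open>A degenerate pivot makes the step the identity, but then positivity has
        already annihilated its column.\<close>
      have "schur G p n i (p n) = 0" if "schur G p n (p n) (p n) = 0"
        using psd_on_zero_diag[OF psdn pivot_in \<open>i \<in> I\<close>] that by simp
      then show ?thesis by (auto simp: True schur_step_def)
    next
      case False
      then have "k < n" using Suc.prems by simp
      then show ?thesis using Suc.IH[of i] Suc.IH[of "p n"] Suc.prems by (simp add: schur_step_def)
    qed
  qed simp
  show "schur G p n i (p k) = 0" using *[OF i] .
  then show "schur G p n (p k) i = 0"
    using psd_on_herm[OF psd_on_schur pivot_in i] by simp
qed

lemma schur_step_coord:
  assumes i: "i \<in> I" and j: "j \<in> I"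
  shows "schur G p (Suc n) i j = schur G p n i j - schur_coord G p i n * cnj (schur_coord G p j n)"
proof -
  note psdn = psd_on_schur[of n]
  define g where "g = Re (schur G p n (p n) (p n))"
  have g: "schur G p n (p n) (p n) = complex_of_real g" "0 \<le> g"
    using psd_on_diag[OF psdn pivot_in] by (simp_all add: g_def)
  have "complex_of_real (sqrt g) * complex_of_real (sqrt g) = complex_of_real g"
    using g(2) by (simp flip: of_real_mult)
  then show ?thesis
    unfolding schur_coord_def schur.simps schur_step_def
    using psd_on_herm[OF psdn pivot_in j, of n] by (simp add: g flip: g_def)
qed

lemma schur_decomp:
  assumes i: "i \<in> I" and j: "j \<in> I"
  shows "G i j = schur G p n i j + (\<Sum>k<n. schur_coord G p i k * cnj (schur_coord G p j k))"
  by (induction n) (simp_all add: schur_step_coord[OF i j] del: schur.simps(2))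

lemma schur_diag_decomp:
  assumes i: "i \<in> I"
  shows "Re (G i i) = Re (schur G p n i i) + (\<Sum>k<n. (cmod (schur_coord G p i k))\<^sup>2)"
  by (subst schur_decomp[OF i i, of n], unfold complex_norm_square[symmetric])
     (simp del: of_real_power)

lemma schur_coord_pivot:
  assumes "k < n"
  shows "schur_coord G p (p k) n = 0"
  using schur_pivot(2)[OF pivot_in \<open>k < n\<close>] by (simp add: schur_coord_def)

text \<open>The \<open>n\<close>-th coordinate of the pivot \<open>p n\<close> is the square root of
  its residual diagonal entry. If it vanishes, the pivot is degenerate and coordinate
  \<open>n\<close> is dead for every point.\<close>

lemma schur_coord_zero:
  assumes i: "i \<in> I" and "schur_coord G p (p n) n = 0"
  shows "schur_coord G p i n = 0"
proof -
  note psdn = psd_on_schur[of n]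
  have "Re (schur G p n (p n) (p n)) = 0"
    using assms(2) psd_on_diag[OF psdn pivot_in] by (auto simp: schur_coord_def)
  then show ?thesis by (simp add: schur_coord_def)
qed

text \<open>In vector terms, the component of \<open>i\<close> orthogonal to the first
  \<open>n\<close> pivots is no longer than the distance to any one of them. Since
  \<open>p k\<close> has no residual left, the difference of the two sides is the squared distance
  of the coordinates.\<close>

lemma schur_diag_le_dist:
  assumes i: "i \<in> I" and "k < n"
  shows "Re (schur G p n i i) \<le> kernel_dist2 G i (p k)"
proof -
  let ?f = "schur_coord G p"
  have "kernel_dist2 G i (p k) = Re (schur G p n i i) + (\<Sum>m<n. (cmod (?f i m))\<^sup>2 + (cmod (?f (p k) m))\<^sup>2
     - Re (?f i m * cnj (?f (p k) m)) - Re (?f (p k) m * cnj (?f i m)))"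
    unfolding kernel_dist2_def plus_complex.sel minus_complex.sel
    using schur_diag_decomp[OF i, of n] schur_diag_decomp[OF pivot_in, of k n]
      schur_decomp[OF i pivot_in, of k n] schur_decomp[OF pivot_in i, of k n]
      schur_pivot[OF i \<open>k < n\<close>] schur_pivot[OF pivot_in \<open>k < n\<close>, of k]
    by (simp add: sum.distrib sum_subtractf del: times_complex.sel)
  also have "(\<Sum>m<n. (cmod (?f i m))\<^sup>2 + (cmod (?f (p k) m))\<^sup>2
     - Re (?f i m * cnj (?f (p k) m)) - Re (?f (p k) m * cnj (?f i m)))
     = (\<Sum>m<n. (cmod (?f i m - ?f (p k) m))\<^sup>2)"
    by (simp only: cmod_power2) (simp add: power2_eq_square algebra_simps)
  finally show ?thesis by (simp add: sum_nonneg)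
qed

lemma schur_antimono_diag:
  assumes i: "i \<in> I" and "m \<le> n"
  shows "Re (schur G p n i i) \<le> Re (schur G p m i i)"
  using schur_diag_decomp[OF i, of n] schur_diag_decomp[OF i, of m]
    sum_mono2[of "{..<n}" "{..<m}" "\<lambda>k. (cmod (schur_coord G p i k))\<^sup>2"] \<open>m \<le> n\<close> by auto

text \<open>The diagonal entry at \<open>i\<close> tends to zero, and Cauchy-Schwarz carries this
  over to all entries of the row, so only \<open>i\<close> has to be approximated by pivots.\<close>

lemma schur_tendsto_0:
  assumes i: "i \<in> I" and j: "j \<in> I"
    and d: "\<And>\<epsilon>. 0 < \<epsilon> \<Longrightarrow> \<exists>k. kernel_dist2 G i (p k) < \<epsilon>"
  shows "(\<lambda>n. schur G p n i j) \<longlonglongrightarrow> 0"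
proof -
  have lim: "(\<lambda>n. Re (schur G p n i i)) \<longlonglongrightarrow> 0"
  proof (rule LIMSEQ_I)
    fix e :: real assume "0 < e"
    then obtain k where k: "kernel_dist2 G i (p k) < e" using d by blast
    show "\<exists>no. \<forall>n\<ge>no. norm (Re (schur G p n i i) - 0) < e"
    proof (intro exI allI impI)
      fix n assume "Suc k \<le> n"
      then show "norm (Re (schur G p n i i) - 0) < e"
        using schur_diag_le_dist[OF i, of k n] psd_on_diag(1)[OF psd_on_schur i, of n] k by simp
    qed
  qed
  have "(\<lambda>n. sqrt (Re (schur G p n i i) * Re (G j j))) \<longlonglongrightarrow> sqrt (0 * Re (G j j))"
    by (intro tendsto_intros lim)
  then have lim2: "(\<lambda>n. sqrt (Re (schur G p n i i) * Re (G j j))) \<longlonglongrightarrow> 0" by simp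
  show ?thesis
  proof (rule Lim_null_comparison[OF always_eventually lim2], rule allI)
    fix n
    note psdn = psd_on_schur[of n]
    have "(cmod (schur G p n i j))\<^sup>2 \<le> Re (schur G p n i i) * Re (schur G p n j j)"
      by (rule psd_on_Cauchy_Schwarz[OF psdn i j])
    also have "\<dots> \<le> Re (schur G p n i i) * Re (G j j)"
      using schur_antimono_diag[OF j, of 0 n] psd_on_diag(1)[OF psdn i]
      by (intro mult_left_mono) auto
    finally show "norm (schur G p n i j) \<le> sqrt (Re (schur G p n i i) * Re (G j j))"
      by (simp add: real_le_rsqrt)
  qed
qed

end

text \<open>A Schur step looks only at kernel values, so it commutes with pulling a kernel back
  along \<open>f\<close>. This is what makes coordinates depend on the Gram matrix alone.\<close>

lemma schur_comp:
  assumes "\<And>i j. i \<in> I \<Longrightarrow> j \<in> I \<Longrightarrow> G i j = H (f i) (f j)" and "\<And>n. p n \<in> I" "i \<in> I" "j \<in> I"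
  shows "schur G p n i j = schur H (\<lambda>n. f (p n)) n (f i) (f j)"
  using assms(3,4) by (induction n arbitrary: i j) (auto simp: schur_step_def assms(1,2))

lemma schur_coord_comp:
  assumes "\<And>i j. i \<in> I \<Longrightarrow> j \<in> I \<Longrightarrow> G i j = H (f i) (f j)" and "\<And>n. p n \<in> I" "i \<in> I"
  shows "schur_coord G p i = schur_coord H (\<lambda>n. f (p n)) (f i)"
proof
  fix n
  have eq: "schur G p n i j = schur H (\<lambda>n. f (p n)) n (f i) (f j)" if "i \<in> I" "j \<in> I" for i j
    by (rule schur_comp[of I G H f p]) (use assms that in auto)
  show "schur_coord G p i n = schur_coord H (\<lambda>n. f (p n)) (f i) n"
    unfolding schur_coord_def by (simp add: eq assms)
qed

section \<open>Square-summable functions\<close>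

text \<open>The index type is arbitrary because the isometry acts on \<open>nat + nat\<close>, whose
  two summands hold the two components of a direct sum.\<close>

definition ell2 :: "('i \<Rightarrow> complex) \<Rightarrow> bool" where
  "ell2 a \<longleftrightarrow> (\<lambda>i. (cmod (a i))\<^sup>2) summable_on UNIV"

definition ip :: "('i \<Rightarrow> complex) \<Rightarrow> ('i \<Rightarrow> complex) \<Rightarrow> complex" where
  "ip a b = (\<Sum>\<^sub>\<infinity>i. a i * cnj (b i))"

lemma ell2_summable_prod:
  assumes "ell2 a" "ell2 b"
  shows "(\<lambda>i. a i * cnj (b i)) summable_on UNIV"
proof (rule abs_summable_summable, rule abs_summable_product)
  show "(\<lambda>i. norm (a i * a i)) summable_on UNIV" "(\<lambda>i. norm (cnj (b i) * cnj (b i))) summable_on UNIV"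
    using assms by (simp_all add: ell2_def norm_mult power2_eq_square)
qed

lemma ell2_zero [simp]: "ell2 (\<lambda>_. 0)"
  by (simp add: ell2_def)

lemma ell2_add:
  assumes "ell2 a" "ell2 b"
  shows "ell2 (\<lambda>i. a i + b i)"
  unfolding ell2_def
proof (rule summable_on_comparison_test)
  show "(\<lambda>i. 2 * (cmod (a i))\<^sup>2 + 2 * (cmod (b i))\<^sup>2) summable_on UNIV"
    using assms unfolding ell2_def by (intro summable_on_add summable_on_cmult_right)
  fix i
  have "(cmod (a i + b i))\<^sup>2 \<le> (cmod (a i) + cmod (b i))\<^sup>2"
    by (intro power_mono norm_triangle_ineq) simp
  also have "\<dots> \<le> 2 * (cmod (a i))\<^sup>2 + 2 * (cmod (b i))\<^sup>2"
    using zero_le_power2[of "cmod (a i) - cmod (b i)"] by (simp add: power2_sum power2_diff)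
  finally show "(cmod (a i + b i))\<^sup>2 \<le> 2 * (cmod (a i))\<^sup>2 + 2 * (cmod (b i))\<^sup>2" .
qed auto

lemma ell2_scale:
  assumes "ell2 a"
  shows "ell2 (\<lambda>i. c * a i)"
  using summable_on_cmult_right[OF assms[unfolded ell2_def], of "(cmod c)\<^sup>2"]
  by (simp add: ell2_def norm_mult power_mult_distrib)

lemma ell2_diff:
  assumes "ell2 a" "ell2 b"
  shows "ell2 (\<lambda>i. a i - b i)"
  using ell2_add[OF assms(1) ell2_scale[OF assms(2), of "-1"]] by simp

lemma ell2_sum:
  assumes "finite S" "\<And>k. k \<in> S \<Longrightarrow> ell2 (a k)"
  shows "ell2 (\<lambda>i. \<Sum>k\<in>S. a k i)"
  using assms by (induction S) (auto intro!: ell2_add)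

lemma ip_commute: "ip a b = cnj (ip b a)"
  unfolding ip_def infsum_cnj[symmetric] by (simp add: mult.commute)

lemma ip_add_left: "ell2 a \<Longrightarrow> ell2 b \<Longrightarrow> ell2 c \<Longrightarrow> ip (\<lambda>i. a i + b i) c = ip a c + ip b c"
  by (simp add: ip_def distrib_right infsum_add ell2_summable_prod)

lemma ip_scale_left: "ip (\<lambda>i. c * a i) b = c * ip a b"
  by (simp add: ip_def mult.assoc infsum_cmult_right')

lemma ip_add_right: "ell2 a \<Longrightarrow> ell2 b \<Longrightarrow> ell2 c \<Longrightarrow> ip c (\<lambda>i. a i + b i) = ip c a + ip c b"
  by (subst (1 2 3) ip_commute) (simp add: ip_add_left)

lemma ip_scale_right: "ip b (\<lambda>i. c * a i) = cnj c * ip b a"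
  by (subst (1 2) ip_commute) (simp add: ip_scale_left)

lemma ip_diff_left: "ell2 a \<Longrightarrow> ell2 b \<Longrightarrow> ell2 c \<Longrightarrow> ip (\<lambda>i. a i - b i) c = ip a c - ip b c"
  using ip_add_left[of a "\<lambda>i. -1 * b i" c] ell2_scale[of b "-1"] ip_scale_left[of "-1" b c] by simp

lemma ip_diff_right: "ell2 a \<Longrightarrow> ell2 b \<Longrightarrow> ell2 c \<Longrightarrow> ip c (\<lambda>i. a i - b i) = ip c a - ip c b"
  by (subst (1 2 3) ip_commute) (simp add: ip_diff_left)

lemma ip_self: "ip a a = complex_of_real (\<Sum>\<^sub>\<infinity>i. (cmod (a i))\<^sup>2)" if "ell2 a"
proof -
  have "((\<lambda>i. complex_of_real ((cmod (a i))\<^sup>2)) has_sum complex_of_real (\<Sum>\<^sub>\<infinity>i. (cmod (a i))\<^sup>2)) UNIV"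
    using that unfolding ell2_def has_sum_of_real_iff by simp
  then show ?thesis
    unfolding ip_def complex_norm_square by (rule infsumI)
qed

lemma Re_ip_self: "Re (ip a a) = (\<Sum>\<^sub>\<infinity>i. (cmod (a i))\<^sup>2)" if "ell2 a"
  using ip_self[OF that] by simp

lemma ip_self_nonneg: "ell2 a \<Longrightarrow> 0 \<le> Re (ip a a)"
  by (simp add: Re_ip_self infsum_nonneg)

lemma ip_self_finite_le: "ell2 a \<Longrightarrow> finite F \<Longrightarrow> (\<Sum>i\<in>F. (cmod (a i))\<^sup>2) \<le> Re (ip a a)"
  by (simp only: Re_ip_self) (rule finite_sum_le_infsum, auto simp: ell2_def)

lemma ell2_component_le: "ell2 a \<Longrightarrow> (cmod (a i))\<^sup>2 \<le> Re (ip a a)"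
  using ip_self_finite_le[of a "{i}"] by simp

lemma ip_definite: "ell2 a \<Longrightarrow> Re (ip a a) = 0 \<Longrightarrow> a i = 0"
  using ell2_component_le[of a i] by simp

lemma ell2_bounded:
  assumes "\<And>F. finite F \<Longrightarrow> (\<Sum>i\<in>F. (cmod (a i))\<^sup>2) \<le> C"
  shows "ell2 a" "Re (ip a a) \<le> C"
proof -
  show "ell2 a" unfolding ell2_def
    by (rule nonneg_bdd_above_summable_on) (auto intro!: bdd_aboveI2 assms)
  then show "Re (ip a a) \<le> C"
    by (simp only: Re_ip_self) (rule infsum_le_finite_sums, auto simp: ell2_def intro: assms)
qed

lemma ell2_nat_bounded:
  fixes a :: "nat \<Rightarrow> complex"
  assumes "\<And>n. (\<Sum>i<n. (cmod (a i))\<^sup>2) \<le> C"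
  shows "ell2 a" "Re (ip a a) \<le> C"
proof -
  have "(\<Sum>i\<in>F. (cmod (a i))\<^sup>2) \<le> C" if "finite F" for F
  proof -
    from finite_nat_bounded[OF that] obtain n where "F \<subseteq> {..<n}" by blast
    then have "(\<Sum>i\<in>F. (cmod (a i))\<^sup>2) \<le> (\<Sum>i<n. (cmod (a i))\<^sup>2)" by (intro sum_mono2) auto
    then show ?thesis using assms order_trans by blast
  qed
  from ell2_bounded[of a, OF this] show "ell2 a" "Re (ip a a) \<le> C" by auto
qed

lemma ell2_finite_support:
  assumes "finite F" "\<And>i. i \<notin> F \<Longrightarrow> a i = 0"
  shows "ell2 a" and "ip a b = (\<Sum>i\<in>F. a i * cnj (b i))"
proof -
  show "ell2 a" unfolding ell2_def
    using summable_on_cong_neutral[of F UNIV "\<lambda>i. (cmod (a i))\<^sup>2" "\<lambda>i. (cmod (a i))\<^sup>2"] assms by auto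
  have "ip a b = infsum (\<lambda>i. a i * cnj (b i)) F"
    unfolding ip_def by (rule infsum_cong_neutral) (auto simp: assms)
  then show "ip a b = (\<Sum>i\<in>F. a i * cnj (b i))" by (simp add: assms)
qed

definition delta :: "'i \<Rightarrow> 'i \<Rightarrow> complex" where
  "delta m i = (if i = m then 1 else 0)"

lemma ell2_delta [simp]: "ell2 (delta m)"
  by (rule ell2_finite_support[of "{m}"]) (auto simp: delta_def)

lemma ip_delta: "ip a (delta m) = a m"
  by (subst ip_commute, subst ell2_finite_support(2)[of "{m}"]) (auto simp: delta_def)

lemma ip_sum_left:
  assumes "finite S" "\<And>k. k \<in> S \<Longrightarrow> ell2 (a k)" "ell2 b"
  shows "ip (\<lambda>i. \<Sum>k\<in>S. a k i) b = (\<Sum>k\<in>S. ip (a k) b)"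
  using assms
proof (induction S)
  case empty then show ?case by (simp add: ip_def)
next
  case (insert k S) then show ?case by (simp add: ip_add_left ell2_sum)
qed

lemma ip_sum_right:
  assumes "finite S" "\<And>k. k \<in> S \<Longrightarrow> ell2 (a k)" "ell2 b"
  shows "ip b (\<lambda>i. \<Sum>k\<in>S. a k i) = (\<Sum>k\<in>S. ip b (a k))"
  by (subst ip_commute, subst ip_sum_left[OF assms]) (simp_all flip: ip_commute)

text \<open>This opens the kernel machinery to the inner product itself, with vectors as indices;
  Cauchy-Schwarz and the coordinate maps below are instances.\<close>

lemma psd_on_ip: "psd_on (Collect ell2) ip"
  unfolding psd_on_def
proof (intro conjI ballI allI impI)
  fix n :: nat and t :: "nat \<Rightarrow> 'a \<Rightarrow> complex" and c
  assume t: "\<forall>k<n. t k \<in> Collect ell2"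
  define v where "v = (\<lambda>i. \<Sum>k<n. c k * t k i)"
  have e: "ell2 (\<lambda>i. c k * t k i)" if "k < n" for k using t that by (auto intro: ell2_scale)
  have v: "ell2 v" unfolding v_def by (rule ell2_sum) (auto intro: e)
  have "ip v v = (\<Sum>k<n. ip (\<lambda>i. c k * t k i) v)"
    by (subst (1) v_def, rule ip_sum_left) (auto intro: e v)
  also have "\<dots> = (\<Sum>k<n. \<Sum>l<n. ip (\<lambda>i. c k * t k i) (\<lambda>i. c l * t l i))"
    unfolding v_def by (intro sum.cong refl ip_sum_right) (auto intro: e)
  also have "\<dots> = (\<Sum>k<n. \<Sum>l<n. ip (t k) (t l) * c k * cnj (c l))"
    by (simp add: ip_scale_left ip_scale_right mult_ac)
  finally show "0 \<le> Re (\<Sum>k<n. \<Sum>l<n. ip (t k) (t l) * c k * cnj (c l))"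
    using ip_self_nonneg[OF v] by simp
qed (rule ip_commute)

lemma ip_Cauchy_Schwarz:
  "ell2 a \<Longrightarrow> ell2 b \<Longrightarrow> (cmod (ip a b))\<^sup>2 \<le> Re (ip a a) * Re (ip b b)"
  using psd_on_Cauchy_Schwarz[OF psd_on_ip] by auto

lemma kernel_dist2_ip:
  "ell2 a \<Longrightarrow> ell2 b \<Longrightarrow> kernel_dist2 ip a b = Re (ip (\<lambda>i. a i - b i) (\<lambda>i. a i - b i))"
  by (simp add: kernel_dist2_def ip_diff_left ip_diff_right ell2_diff)

lemma range_Inl_Un_range_Inr: "range Inl \<union> range Inr = UNIV"
proof -
  have "x \<in> range Inl \<union> range Inr" for x :: "'a + 'b" by (cases x) auto
  then show ?thesis by blast
qed

lemma ip_Sum: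
  fixes a b :: "'i + 'j \<Rightarrow> complex"
  assumes "ell2 a" "ell2 b"
  shows "ip a b = ip (a \<circ> Inl) (b \<circ> Inl) + ip (a \<circ> Inr) (b \<circ> Inr)"
proof -
  have s: "(\<lambda>i. a i * cnj (b i)) summable_on S" for S
    using ell2_summable_prod[OF assms] summable_on_subset_banach by blast
  have "ip a b = infsum (\<lambda>i. a i * cnj (b i)) (range Inl \<union> range Inr)"
    by (simp add: ip_def range_Inl_Un_range_Inr)
  also have "\<dots> = infsum (\<lambda>i. a i * cnj (b i)) (range Inl) + infsum (\<lambda>i. a i * cnj (b i)) (range Inr)"
    by (rule infsum_Un_disjoint) (auto intro: s)
  finally show ?thesis
    by (simp add: infsum_reindex ip_def o_def)
qed

lemma ell2_comp_inj:
  assumes "ell2 a" "inj f"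
  shows "ell2 (\<lambda>i. a (f i))"
proof -
  have "(\<lambda>i. (cmod (a i))\<^sup>2) summable_on range f"
    using assms(1) summable_on_subset_banach unfolding ell2_def by blast
  then show ?thesis using summable_on_reindex[OF assms(2), of "\<lambda>i. (cmod (a i))\<^sup>2"] by (simp add: ell2_def o_def)
qed

lemma ell2_Sum:
  fixes a :: "'i + 'j \<Rightarrow> complex"
  assumes "ell2 (\<lambda>i. a (Inl i))" "ell2 (\<lambda>i. a (Inr i))"
  shows "ell2 a"
proof -
  have "(\<lambda>i. (cmod (a i))\<^sup>2) summable_on (range Inl \<union> range Inr)"
    using assms unfolding ell2_def
    by (intro summable_on_Un_disjoint) (auto simp: summable_on_reindex o_def)
  then show ?thesis by (simp add: ell2_def range_Inl_Un_range_Inr)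
qed

text \<open>Riesz representation for a bounded conjugate linear functional. The representing
  sequence can only be \<open>B (delta m)\<close>; boundedness of \<open>B\<close> first makes it
  square summable and then lets the truncations of \<open>v\<close> pass to the limit.\<close>

lemma ell2_riesz:
  fixes B :: "('j \<Rightarrow> complex) \<Rightarrow> complex"
  assumes add: "\<And>u v. ell2 u \<Longrightarrow> ell2 v \<Longrightarrow> B (\<lambda>i. u i + v i) = B u + B v"
    and scale: "\<And>c u. ell2 u \<Longrightarrow> B (\<lambda>i. c * u i) = cnj c * B u"
    and bound: "\<And>u. ell2 u \<Longrightarrow> (cmod (B u))\<^sup>2 \<le> C * Re (ip u u)"
  shows "ell2 (\<lambda>m. B (delta m))" and "ell2 v \<Longrightarrow> ip (\<lambda>m. B (delta m)) v = B v"
proof -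
  define b where "b = (\<lambda>m. B (delta m))"
  have trunc: "B (\<lambda>i. if i \<in> F then v i else 0) = (\<Sum>m\<in>F. b m * cnj (v m))" if "finite F" for F v
    using that
  proof (induction F)
    case empty then show ?case using scale[of "\<lambda>_. 0" 0] by simp
  next
    case (insert m F)
    have "(\<lambda>i. if i \<in> insert m F then v i else 0) = (\<lambda>i. (v m * delta m i) + (if i \<in> F then v i else 0))"
      using insert.hyps by (auto simp: delta_def)
    moreover have "ell2 (\<lambda>i. if i \<in> F then v i else 0)"
      by (rule ell2_finite_support[of F]) (use insert.hyps in auto)
    ultimately show ?case
      using insert by (simp add: add scale ell2_scale b_def mult.commute)
  qed
  have C: "(cmod (B u))\<^sup>2 \<le> \<bar>C\<bar> * Re (ip u u)" if "ell2 u" for u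
    using bound[OF that] mult_right_mono[OF abs_ge_self[of C] ip_self_nonneg[OF that]] by linarith
  have "(\<Sum>i\<in>F. (cmod (b i))\<^sup>2) \<le> \<bar>C\<bar>" if F: "finite F" for F
  proof -
    \<comment> \<open>The truncated candidate is its own test vector: \<open>B u\<close> and
      \<open>ip u u\<close> are both \<open>S\<close>, so the bound reads
      \<open>S\<^sup>2 \<le> \<bar>C\<bar> * S\<close>.\<close>
    define u where "u = (\<lambda>i. if i \<in> F then b i else 0)"
    define S where "S = (\<Sum>i\<in>F. (cmod (b i))\<^sup>2)"
    have u: "ell2 u" "ip u u = complex_of_real S"
      using ell2_finite_support(1)[OF F, of u] ell2_finite_support(2)[OF F, of u u]
      by (simp_all add: u_def S_def complex_norm_square del: of_real_power)
    have "B u = complex_of_real S"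
      unfolding u_def trunc[OF F] by (simp add: S_def complex_norm_square del: of_real_power)
    then have "S\<^sup>2 \<le> \<bar>C\<bar> * S" using C[OF u(1)] u(2) by (simp del: of_real_power)
    moreover have "0 \<le> S" by (simp add: S_def sum_nonneg)
    ultimately have "S \<le> \<bar>C\<bar>" by (cases "S = 0") (auto simp: power2_eq_square)
    then show ?thesis by (simp add: S_def)
  qed
  then have b: "ell2 b" by (rule ell2_bounded(1))
  then show "ell2 (\<lambda>m. B (delta m))" by (simp add: b_def)
  assume v: "ell2 v"
  have "((\<lambda>m. b m * cnj (v m)) has_sum B v) UNIV"
    unfolding has_sum_def
  proof (rule tendsto_norm_zero_cancel[THEN LIM_zero_cancel])
    define V where "V = (\<Sum>\<^sub>\<infinity>i. (cmod (v i))\<^sup>2)"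
    have "((\<lambda>F. \<Sum>i\<in>F. (cmod (v i))\<^sup>2) \<longlongrightarrow> V) (finite_subsets_at_top UNIV)"
      using v unfolding ell2_def V_def by (rule infsum_tendsto)
    then have "((\<lambda>F. sqrt (\<bar>C\<bar> * (V - (\<Sum>i\<in>F. (cmod (v i))\<^sup>2)))) \<longlongrightarrow> sqrt (\<bar>C\<bar> * (V - V))) (finite_subsets_at_top UNIV)"
      by (intro tendsto_intros)
    then have lim: "((\<lambda>F. sqrt (\<bar>C\<bar> * (V - (\<Sum>i\<in>F. (cmod (v i))\<^sup>2)))) \<longlongrightarrow> 0) (finite_subsets_at_top UNIV)"
      by simp
    show "((\<lambda>F. norm ((\<Sum>i\<in>F. b i * cnj (v i)) - B v)) \<longlongrightarrow> 0) (finite_subsets_at_top UNIV)"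
    proof (rule Lim_null_comparison[OF _ lim], rule eventually_finite_subsets_at_top_weakI)
      fix F :: "'j set" assume F: "finite F"
      define w where "w = (\<lambda>i. if i \<in> F then v i else 0)"
      have w: "ell2 w" by (rule ell2_finite_support[OF F]) (simp add: w_def)
      \<comment> \<open>Up to sign this is the tail of \<open>v\<close> outside \<open>F\<close>,
        whose squared norm is \<open>V\<close> minus the partial sum over \<open>F\<close>.\<close>
      define d where "d = (\<lambda>i. w i + -1 * v i)"
      have d: "ell2 d" unfolding d_def by (intro ell2_add ell2_scale w v)
      have eq: "(\<Sum>i\<in>F. b i * cnj (v i)) - B v = B d"
        unfolding d_def by (subst add) (use w v ell2_scale[OF v, of "-1"] scale[OF v, of "-1"] in \<open>auto simp: w_def trunc F\<close>)
      have "Re (ip w w) = (\<Sum>i\<in>F. (cmod (v i))\<^sup>2)" 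
        by (subst ell2_finite_support(2)[OF F])
           (auto simp: w_def complex_norm_square[symmetric] simp del: of_real_power)
      moreover have "ip w v = ip w w" "ip v w = ip w w"
      proof -
        show "ip w v = ip w w" by (subst (1 2) ell2_finite_support(2)[OF F]) (auto simp: w_def)
        then show "ip v w = ip w w" by (metis ip_commute)
      qed
      ultimately have "Re (ip d d) = V - (\<Sum>i\<in>F. (cmod (v i))\<^sup>2)"
        using ip_diff_left[OF w v ell2_diff[OF w v]] ip_diff_right[OF w v w] ip_diff_right[OF w v v] Re_ip_self[OF v]
        by (simp add: d_def V_def)
      with C[OF d] show "norm (norm ((\<Sum>i\<in>F. b i * cnj (v i)) - B v)) \<le> sqrt (\<bar>C\<bar> * (V - (\<Sum>i\<in>F. (cmod (v i))\<^sup>2)))"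
        unfolding eq by (simp add: real_le_rsqrt)
    qed
  qed
  then show "ip (\<lambda>m. B (delta m)) v = B v" unfolding ip_def b_def by (rule infsumI)
qed

section \<open>Bessel, Parseval and linearity for kernel coordinates\<close>

context pivoted_kernel begin

text \<open>Bessel's inequality: the residual diagonal entry stays nonnegative.\<close>

lemma ell2_schur_coord:
  assumes "i \<in> I"
  shows "ell2 (schur_coord G p i)" "Re (ip (schur_coord G p i) (schur_coord G p i)) \<le> Re (G i i)"
proof -
  have "(\<Sum>k<n. (cmod (schur_coord G p i k))\<^sup>2) \<le> Re (G i i)" for n
    using schur_diag_decomp[OF assms, of n] psd_on_diag(1)[OF psd_on_schur assms] by simp
  from ell2_nat_bounded[of "schur_coord G p i", OF this]
  show "ell2 (schur_coord G p i)" "Re (ip (schur_coord G p i) (schur_coord G p i)) \<le> Re (G i i)"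
    by auto
qed

text \<open>Parseval's identity. It suffices that one of the two points is a limit of pivots, since
  the residual entry at \<open>i\<close>, \<open>j\<close> then vanishes in the limit.\<close>

lemma ip_schur_coord:
  assumes i: "i \<in> I" and j: "j \<in> I" and d: "\<And>\<epsilon>. 0 < \<epsilon> \<Longrightarrow> \<exists>k. kernel_dist2 G i (p k) < \<epsilon>"
  shows "ip (schur_coord G p i) (schur_coord G p j) = G i j"
proof -
  let ?t = "\<lambda>k. schur_coord G p i k * cnj (schur_coord G p j k)"
  have l: "(?t has_sum ip (schur_coord G p i) (schur_coord G p j)) UNIV"
    unfolding ip_def using ell2_summable_prod[OF ell2_schur_coord(1)[OF i] ell2_schur_coord(1)[OF j]]
    by (rule has_sum_infsum)
  from has_sum_imp_sums[OF l]
  have lim: "(\<lambda>n. \<Sum>k<n. ?t k) \<longlonglongrightarrow> ip (schur_coord G p i) (schur_coord G p j)"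
    by (simp add: sums_def)
  have "(\<lambda>n. G i j - schur G p n i j) \<longlonglongrightarrow> G i j - 0"
    by (intro tendsto_intros schur_tendsto_0 i j d)
  moreover have "G i j - schur G p n i j = (\<Sum>k<n. ?t k)" for n
    using schur_decomp[OF i j, of n] by (simp add: algebra_simps)
  ultimately have "(\<lambda>n. \<Sum>k<n. ?t k) \<longlonglongrightarrow> G i j" by simp
  with lim show ?thesis by (rule LIMSEQ_unique)
qed

text \<open>The index set has no linear structure, so a linear relation is expressed by the kernel
  rows; every Schur step preserves it.\<close>

lemma schur_linear:
  assumes "z \<in> I" "x \<in> I" "y \<in> I" and "\<And>j. j \<in> I \<Longrightarrow> G z j = c * G x j + d * G y j" and "j \<in> I"
  shows "schur G p n z j = c * schur G p n x j + d * schur G p n y j"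
  using assms(5) by (induction n arbitrary: j)
    (auto simp: assms(4) schur_step_def algebra_simps add_divide_distrib)

lemma schur_coord_linear:
  assumes "z \<in> I" "x \<in> I" "y \<in> I" and "\<And>j. j \<in> I \<Longrightarrow> G z j = c * G x j + d * G y j"
  shows "schur_coord G p z n = c * schur_coord G p x n + d * schur_coord G p y n"
  unfolding schur_coord_def by (subst schur_linear[OF assms]) (simp_all add: add_divide_distrib)

end

section \<open>The lurking isometry\<close>

text \<open>The coordinates of the pivots form a triangular system: \<open>p n\<close> has no
  coordinate beyond \<open>n\<close>. Hence testing against \<open>p n\<close> isolates entry
  \<open>n\<close> once the earlier entries agree, unless that coordinate is dead.\<close>

lemma (in pivoted_kernel) schur_coord_unique:
  assumes b: "ell2 b" "ell2 b'"
    and eq: "\<And>k. ip b (schur_coord G p (p k)) = ip b' (schur_coord G p (p k))"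
    and dead: "\<And>n. schur_coord G p (p n) n = 0 \<Longrightarrow> b n = b' n"
  shows "b n = b' n"
proof (induction n rule: less_induct)
  case (less n)
  let ?f = "schur_coord G p (p n)"
  have f: "ell2 ?f" by (rule ell2_schur_coord(1)) simp
  have "0 = ip (\<lambda>i. b i - b' i) ?f"
    by (simp add: ip_diff_left b f eq)
  also have "\<dots> = cnj (ip ?f (\<lambda>i. b i - b' i))" by (rule ip_commute)
  also have "ip ?f (\<lambda>i. b i - b' i) = (\<Sum>i\<in>{..n}. ?f i * cnj (b i - b' i))"
    by (rule ell2_finite_support(2)) (auto intro: schur_coord_pivot)
  also have "\<dots> = (\<Sum>i\<in>{n}. ?f i * cnj (b i - b' i))"
    by (rule sum.mono_neutral_right) (auto simp: less)
  finally have "?f n = 0 \<or> b n = b' n" by auto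
  then show ?case using dead by blast
qed

text \<open>The families live in unrelated sequence spaces and share only their index type and Gram
  kernel. Using one pivot sequence \<open>s\<close> on both sides makes the \<open>n\<close>-th
  coordinates correspond.\<close>

locale gram_pair =
  fixes x :: "'t \<Rightarrow> 'i \<Rightarrow> complex" and y :: "'t \<Rightarrow> 'j \<Rightarrow> complex" and s :: "nat \<Rightarrow> 't"
  assumes x: "ell2 (x t)" and y: "ell2 (y t)" and gram: "ip (x t) (x u) = ip (y t) (y u)"
begin

sublocale X: pivoted_kernel "Collect ell2" ip "\<lambda>n. x (s n)"
  by unfold_locales (simp_all add: psd_on_ip x)

sublocale Y: pivoted_kernel "Collect ell2" ip "\<lambda>n. y (s n)"
  by unfold_locales (simp_all add: psd_on_ip y)

text \<open>The partial isometry that maps the closed span of the \<open>x (s n)\<close> onto that of the \<open>y (s n)\<close>,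
  in coordinates \<open>\<langle>cy\<^sup>* (cx a), \<delta>\<^sub>m\<rangle>\<close>: the coordinate maps \<open>cx\<close> and \<open>cy\<close> are partial
  isometries that agree on corresponding vectors because they only depend on the Gram matrix.\<close>

definition transport :: "('i \<Rightarrow> complex) \<Rightarrow> 'j \<Rightarrow> complex" where
  "transport a m = ip (schur_coord ip (\<lambda>n. x (s n)) a) (schur_coord ip (\<lambda>n. y (s n)) (delta m))"

abbreviation "cx \<equiv> schur_coord ip (\<lambda>n. x (s n))"
abbreviation "cy \<equiv> schur_coord ip (\<lambda>n. y (s n))"

lemma ell2_cx: "ell2 a \<Longrightarrow> ell2 (cx a)"
  using X.ell2_schur_coord(1)[of a] by simp

lemma ell2_cy: "ell2 a \<Longrightarrow> ell2 (cy a)"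
  using Y.ell2_schur_coord(1)[of a] by simp

text \<open>Both are the coordinates of one kernel on the index type \<open>'t\<close>, the common
  Gram kernel.\<close>

lemma cx_eq_cy: "cx (x t) = cy (y t)"
proof -
  have "schur_coord (\<lambda>t u. ip (x t) (x u)) s t = cx (x t)"
    by (rule schur_coord_comp[where I = UNIV]) auto
  moreover have "schur_coord (\<lambda>t u. ip (x t) (x u)) s t = cy (y t)"
    by (rule schur_coord_comp[where I = UNIV]) (auto simp: gram)
  ultimately show ?thesis by simp
qed

text \<open>The functional \<open>v \<mapsto> ip (cx a) (cy v)\<close> is bounded because
  \<open>cy\<close> is a contraction by Bessel, so Riesz extends the defining identity of
  \<open>transport\<close> from the basis vectors to all \<open>v\<close>.\<close>

lemma transport_riesz:
  assumes a: "ell2 a"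
  shows "ell2 (transport a)" and "ell2 v \<Longrightarrow> ip (transport a) v = ip (cx a) (cy v)"
proof -
  have lin: "cy (\<lambda>i. c * u i + d * v i) n = c * cy u n + d * cy v n" if "ell2 u" "ell2 v" for c d u v n
    by (rule Y.schur_coord_linear)
       (use that in \<open>auto simp: ell2_add ell2_scale ip_add_left ip_scale_left\<close>)
  have 1: "ip (cx a) (cy (\<lambda>i. u i + v i)) = ip (cx a) (cy u) + ip (cx a) (cy v)" if "ell2 u" "ell2 v" for u v
  proof -
    have "cy (\<lambda>i. u i + v i) = (\<lambda>n. cy u n + cy v n)" using lin[OF that, of 1 1] by auto
    then show ?thesis using that by (simp add: ip_add_right ell2_cx ell2_cy a)
  qed
  have 2: "ip (cx a) (cy (\<lambda>i. c * u i)) = cnj c * ip (cx a) (cy u)" if "ell2 u" for c u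
  proof -
    have "cy (\<lambda>i. c * u i) = (\<lambda>n. c * cy u n)" using lin[OF that that, of c 0] by auto
    then show ?thesis by (simp add: ip_scale_right)
  qed
  have 3: "(cmod (ip (cx a) (cy u)))\<^sup>2 \<le> Re (ip (cx a) (cx a)) * Re (ip u u)" if "ell2 u" for u
  proof -
    have "(cmod (ip (cx a) (cy u)))\<^sup>2 \<le> Re (ip (cx a) (cx a)) * Re (ip (cy u) (cy u))"
      by (intro ip_Cauchy_Schwarz ell2_cx ell2_cy a that)
    also have "\<dots> \<le> Re (ip (cx a) (cx a)) * Re (ip u u)"
      using Y.ell2_schur_coord(2)[of u] that by (intro mult_left_mono ip_self_nonneg ell2_cx a) auto
    finally show ?thesis .
  qed
  have eq: "transport a = (\<lambda>m. ip (cx a) (cy (delta m)))" by (simp add: transport_def fun_eq_iff)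
  show "ell2 (transport a)" unfolding eq by (rule ell2_riesz(1)) (rule 1 2 3; assumption)+
  show "ip (transport a) v = ip (cx a) (cy v)" if "ell2 v"
    unfolding eq by (rule ell2_riesz(2)[OF _ _ _ that]) (rule 1 2 3; assumption)+
qed

lemma pivot_approx: "0 < \<epsilon> \<Longrightarrow> \<exists>k. kernel_dist2 ip a (y (s k)) < \<epsilon>" if "a = y (s m)"
  by (rule exI[of _ m]) (simp add: that kernel_dist2_def)

text \<open>This says that \<open>cx a\<close> lies in the range on which \<open>cy\<close> composed
  with its adjoint is the identity. Against the coordinates of a pivot, Parseval and the adjoint
  identity give equal inner products. The dead coordinates on the two sides are the same by
  \<open>cx_eq_cy\<close>, and there both sequences vanish.\<close>

lemma cy_transport:
  assumes a: "ell2 a"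
  shows "cy (transport a) = cx a"
proof
  fix n
  note ta = transport_riesz(1)[OF a]
  show "cy (transport a) n = cx a n"
  proof (rule Y.schur_coord_unique)
    show "ell2 (cy (transport a))" "ell2 (cx a)" by (simp_all add: ell2_cx ell2_cy a ta)
    fix k
    have "ip (cy (y (s k))) (cy (transport a)) = ip (y (s k)) (transport a)"
      by (rule Y.ip_schur_coord) (auto simp: ta y intro: pivot_approx)
    then have "ip (cy (transport a)) (cy (y (s k))) = ip (transport a) (y (s k))"
      by (metis ip_commute)
    then show "ip (cy (transport a)) (cy (y (s k))) = ip (cx a) (cy (y (s k)))"
      by (simp add: transport_riesz(2)[OF a] y)
  next
    fix n assume n: "cy (y (s n)) n = 0"
    then have "cx (x (s n)) n = 0" by (simp add: cx_eq_cy)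
    with X.schur_coord_zero[of a n] Y.schur_coord_zero[of "transport a" n] n
    show "cy (transport a) n = cx a n" by (simp add: a ta)
  qed
qed

lemma ip_transport:
  assumes "ell2 a" "ell2 b"
  shows "ip (transport a) (transport b) = ip (cx a) (cx b)"
  by (simp add: transport_riesz assms cy_transport)

text \<open>Distances within the two families agree, so approximability by pivots passes from
  \<open>x\<close> to \<open>y\<close>, where Parseval against \<open>delta m\<close> reads off
  entry \<open>m\<close>.\<close>

lemma transport_eq:
  assumes "\<And>\<epsilon>. 0 < \<epsilon> \<Longrightarrow> \<exists>k. kernel_dist2 ip (x t) (x (s k)) < \<epsilon>"
  shows "transport (x t) = y t"
proof
  fix m
  have "kernel_dist2 ip (x t) (x (s k)) = kernel_dist2 ip (y t) (y (s k))" for k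
    by (simp add: kernel_dist2_def gram)
  with assms have "ip (cy (y t)) (cy (delta m)) = ip (y t) (delta m)"
    by (intro Y.ip_schur_coord) (simp_all add: y)
  then show "transport (x t) m = y t m"
    by (simp add: transport_def cx_eq_cy ip_delta)
qed

text \<open>Here \<open>delta m\<close> is orthogonal to every \<open>y t\<close>, so all its
  coordinates along the pivots are zero. This keeps free coordinates free.\<close>

lemma transport_vanishes:
  assumes "\<And>t. y t m = 0"
  shows "transport a m = 0"
proof -
  have "schur ip (\<lambda>n. y (s n)) n (delta m) (y t) = 0" for n t
  proof (induction n arbitrary: t)
    case 0 then show ?case by (subst schur.simps, subst ip_commute) (simp add: ip_delta assms)
  qed (simp add: schur_step_def)
  then have "cy (delta m) = (\<lambda>_. 0)" by (simp add: schur_coord_def fun_eq_iff)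
  then show ?thesis by (simp add: transport_def ip_def)
qed

end

text \<open>The isometry of sequence spaces induced by an injection; by \<open>ip_push_left\<close>
  its adjoint is composition with that injection.\<close>

definition push :: "('i \<Rightarrow> 'j) \<Rightarrow> ('i \<Rightarrow> complex) \<Rightarrow> 'j \<Rightarrow> complex" where
  "push f a m = (if m \<in> range f then a (inv_into UNIV f m) else 0)"

lemma push_apply: "inj f \<Longrightarrow> push f a (f i) = a i"
  by (simp add: push_def)

lemma push_notin: "m \<notin> range f \<Longrightarrow> push f a m = 0"
  by (simp add: push_def)

lemma push_add: "push f (\<lambda>i. a i + b i) m = push f a m + push f b m"
  by (simp add: push_def)

lemma push_diff: "push f (\<lambda>i. a i - b i) m = push f a m - push f b m"
  by (simp add: push_def)

lemma push_scale: "push f (\<lambda>i. c * a i) m = c * push f a m"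
  by (simp add: push_def)

lemma ell2_push:
  assumes "inj f" "ell2 a"
  shows "ell2 (push f a)"
proof -
  have "(\<lambda>m. (cmod (push f a m))\<^sup>2) summable_on range f"
    using assms by (simp add: summable_on_reindex o_def push_apply ell2_def)
  then show ?thesis unfolding ell2_def
    by (rule iffD1[OF summable_on_cong_neutral, rotated -1]) (auto simp: push_notin)
qed

lemma ip_push_left:
  assumes "inj f"
  shows "ip (push f a) b = ip a (\<lambda>i. b (f i))"
proof -
  have "ip (push f a) b = infsum (\<lambda>m. push f a m * cnj (b m)) (range f)"
    unfolding ip_def by (rule infsum_cong_neutral) (auto simp: push_notin)
  then show ?thesis by (simp add: infsum_reindex assms o_def push_apply ip_def)
qed

text \<open>The room left free by the \<open>y t\<close> on \<open>range z\<close> takes a copy of the orthogonal complement of the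
  span of the \<open>x t\<close>, so no comparison of codimensions is needed.\<close>

theorem lurking_isometry:
  fixes x :: "'t \<Rightarrow> 'i \<Rightarrow> complex" and y :: "'t \<Rightarrow> 'j \<Rightarrow> complex" and s :: "nat \<Rightarrow> 't" and z :: "'i \<Rightarrow> 'j"
  assumes x: "\<And>t. ell2 (x t)" and y: "\<And>t. ell2 (y t)"
    and gram: "\<And>t u. ip (x t) (x u) = ip (y t) (y u)"
    and z: "inj z" "\<And>t i. y t (z i) = 0"
  obtains W where "\<And>a. ell2 a \<Longrightarrow> ell2 (W a)"
    and "\<And>a b. ell2 a \<Longrightarrow> ell2 b \<Longrightarrow> ip (W a) (W b) = ip a b"
    and "\<And>t. (\<And>\<epsilon>. 0 < \<epsilon> \<Longrightarrow> \<exists>n. kernel_dist2 ip (x t) (x (s n)) < \<epsilon>) \<Longrightarrow> W (x t) = y t"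
    and "\<And>a m. (\<And>t. y t m = 0) \<Longrightarrow> m \<notin> range z \<Longrightarrow> W a m = 0"
proof -
  interpret V: gram_pair x y s by unfold_locales (rule x y gram)+
  \<comment> \<open>Pairing \<open>x\<close> with itself turns \<open>transport\<close> into the
    orthogonal projection onto the closed span of the pivots, so \<open>Q\<close> is the
    complementary projection.\<close>
  interpret P: gram_pair x x s by unfold_locales (rule x refl)+
  define Q where "Q = (\<lambda>a i. a i - P.transport a i)"
  define W where "W = (\<lambda>a m. V.transport a m + push z (Q a) m)"
  have Vz: "V.transport a (z i) = 0" for a i by (rule V.transport_vanishes) (rule z(2))
  have Q: "ell2 (Q a)" if "ell2 a" for a
    unfolding Q_def by (intro ell2_diff that P.transport_riesz)
  have ip_Q: "ip (Q a) (Q b) = ip a b - ip (V.cx a) (V.cx b)" if "ell2 a" "ell2 b" for a b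
  proof -
    have "ip a (P.transport b) = ip (V.cx a) (V.cx b)"
      using P.transport_riesz(2)[OF that(2,1)] by (metis ip_commute)
    then show ?thesis
      unfolding Q_def using that
      by (simp add: ip_diff_left ip_diff_right ell2_diff P.transport_riesz P.ip_transport P.cy_transport)
  qed
  have ip_push: "ip (push z a) (push z b) = ip a b" for a b
    by (simp add: ip_push_left push_apply z(1))
  have cross: "ip (push z b) (V.transport a) = 0" "ip (V.transport a) (push z b) = 0" for a b
  proof -
    show "ip (push z b) (V.transport a) = 0" unfolding ip_push_left[OF z(1)] Vz by (simp add: ip_def)
    then show "ip (V.transport a) (push z b) = 0" by (metis ip_commute complex_cnj_zero)
  qed
  show ?thesis
  proof (rule that[of W])
    show W: "ell2 (W a)" if "ell2 a" for a
      unfolding W_def by (intro ell2_add V.transport_riesz ell2_push[OF z(1)] Q that)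
    show "ip (W a) (W b) = ip a b" if "ell2 a" "ell2 b" for a b
      unfolding W_def using that
      by (simp add: ip_add_left ip_add_right V.transport_riesz(1) ell2_push z(1) Q ell2_add cross ip_push ip_Q V.ip_transport)
    show "W (x t) = y t" if "\<And>\<epsilon>. 0 < \<epsilon> \<Longrightarrow> \<exists>n. kernel_dist2 ip (x t) (x (s n)) < \<epsilon>" for t
    proof -
      have "Q (x t) = (\<lambda>_. 0)" using P.transport_eq[OF that] by (simp add: Q_def)
      then have "push z (Q (x t)) m = 0" for m by (simp add: push_def)
      then show ?thesis using V.transport_eq[OF that] by (simp add: W_def)
    qed
    show "W a m = 0" if "\<And>t. y t m = 0" "m \<notin> range z" for a m
      using that by (simp add: W_def push_notin V.transport_vanishes)
  qed
qed

text \<open>Preserving inner products forces linearity: the defect \<open>d\<close> is orthogonal to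
  every \<open>W u\<close> and is itself a combination of such vectors, hence orthogonal to
  itself.\<close>

lemma gram_preserving_linear:
  assumes W: "\<And>a. ell2 a \<Longrightarrow> ell2 (W a)" "\<And>a b. ell2 a \<Longrightarrow> ell2 b \<Longrightarrow> ip (W a) (W b) = ip a b"
    and ab: "ell2 a" "ell2 b"
  shows "W (\<lambda>i. c * a i + b i) m = c * W a m + W b m"
proof -
  define e where "e = (\<lambda>i. c * a i + b i)"
  have e: "ell2 e" unfolding e_def by (intro ell2_add ell2_scale ab)
  define d where "d = (\<lambda>m. W e m - (c * W a m + W b m))"
  have d: "ell2 d" unfolding d_def by (intro ell2_diff ell2_add ell2_scale W e ab)
  have ipd: "ip d (W u) = 0" if u: "ell2 u" for u
  proof -
    have "ip d (W u) = ip e u - (c * ip a u + ip b u)"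
      unfolding d_def using u e ab
      by (simp add: ip_diff_left ip_add_left ip_scale_left ell2_add ell2_scale W)
    also have "\<dots> = 0" unfolding e_def by (simp add: ip_add_left ip_scale_left ell2_scale ab u)
    finally show ?thesis .
  qed
  have "ip d d = ip d (W e) - (cnj c * ip d (W a) + ip d (W b))"
    by (subst (2) d_def) (simp add: ip_diff_right ip_add_right ip_scale_right ell2_add ell2_scale W e ab d)
  then have "d m = 0" by (intro ip_definite[OF d]) (simp add: ipd e ab)
  then show ?thesis by (simp add: d_def e_def)
qed

section \<open>Hilbert spaces with explicit carriers\<close>

lemma complex_scalars_simps [simp]:
  "carrier complex_scalars = UNIV" "x \<oplus>\<^bsub>complex_scalars\<^esub> y = x + y"
  "x \<otimes>\<^bsub>complex_scalars\<^esub> y = x * y" "\<zero>\<^bsub>complex_scalars\<^esub> = 0" "\<one>\<^bsub>complex_scalars\<^esub> = 1"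
  by (simp_all add: ring_of_type_algebra_def)

context complex_hilbert_space begin

lemma smult_in [simp, intro]: "x \<in> carrier H \<Longrightarrow> c \<odot>\<^bsub>H\<^esub> x \<in> carrier H"
  using smult_closed[of c x] by simp

lemma minus_eq_smult: "x \<in> carrier H \<Longrightarrow> \<ominus>\<^bsub>H\<^esub> x = (-1) \<odot>\<^bsub>H\<^esub> x"
proof -
  assume x: "x \<in> carrier H"
  have "(-1) \<odot>\<^bsub>H\<^esub> x \<oplus>\<^bsub>H\<^esub> x = (-1 + 1) \<odot>\<^bsub>H\<^esub> x"
    using smult_l_distr[of "-1" 1 x] smult_one x by simp
  also have "\<dots> = \<zero>\<^bsub>H\<^esub>" using smult_l_null x by simp
  finally show ?thesis using x by (intro M.minus_equality) auto
qed

lemma diff_eq_smult: "x \<in> carrier H \<Longrightarrow> y \<in> carrier H \<Longrightarrow> x \<ominus>\<^bsub>H\<^esub> y = x \<oplus>\<^bsub>H\<^esub> (-1) \<odot>\<^bsub>H\<^esub> y"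
  by (simp add: a_minus_def minus_eq_smult)

lemma cinner_add_right:
  "x \<in> carrier H \<Longrightarrow> y \<in> carrier H \<Longrightarrow> z \<in> carrier H \<Longrightarrow>
    cinner H z (x \<oplus>\<^bsub>H\<^esub> y) = cinner H z x + cinner H z y"
  by (subst (1 2 3) cinner_commute) (simp_all add: cinner_add_left)

lemma cinner_smult_right:
  "x \<in> carrier H \<Longrightarrow> z \<in> carrier H \<Longrightarrow> cinner H z (c \<odot>\<^bsub>H\<^esub> x) = cnj c * cinner H z x"
  by (subst (1 2) cinner_commute) (simp_all add: cinner_smult_left)

lemma cinner_diff_left:
  "x \<in> carrier H \<Longrightarrow> y \<in> carrier H \<Longrightarrow> z \<in> carrier H \<Longrightarrow>
    cinner H (x \<ominus>\<^bsub>H\<^esub> y) z = cinner H x z - cinner H y z"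
  by (simp add: diff_eq_smult cinner_add_left cinner_smult_left)

lemma cinner_zero_left: "z \<in> carrier H \<Longrightarrow> cinner H \<zero>\<^bsub>H\<^esub> z = 0"
  using cinner_add_left[of "\<zero>\<^bsub>H\<^esub>" "\<zero>\<^bsub>H\<^esub>" z] by simp

lemma cinner_finsum_left:
  assumes "finite B" "\<And>b. b \<in> B \<Longrightarrow> f b \<in> carrier H" "z \<in> carrier H"
  shows "cinner H (\<Oplus>\<^bsub>H\<^esub>b\<in>B. f b) z = (\<Sum>b\<in>B. cinner H (f b) z)"
  using assms
proof (induction B)
  case empty then show ?case by (simp add: cinner_zero_left)
next
  case (insert b B)
  then have "f \<in> B \<rightarrow> carrier H" by auto
  with insert show ?case by (simp add: cinner_add_left M.finsum_closed)
qed

lemma cinner_finsum_right: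
  assumes "finite B" "\<And>b. b \<in> B \<Longrightarrow> f b \<in> carrier H" "z \<in> carrier H"
  shows "cinner H z (\<Oplus>\<^bsub>H\<^esub>b\<in>B. f b) = (\<Sum>b\<in>B. cinner H z (f b))"
proof -
  have "(\<Oplus>\<^bsub>H\<^esub>b\<in>B. f b) \<in> carrier H" using assms by (intro M.finsum_closed) blast
  then show ?thesis
    by (subst cinner_commute, simp add: assms, assumption, subst cinner_finsum_left)
       (simp_all add: assms cinner_commute[of z])
qed

lemma diff_eq_zero_iff:
  assumes "x \<in> carrier H" "y \<in> carrier H"
  shows "x \<ominus>\<^bsub>H\<^esub> y = \<zero>\<^bsub>H\<^esub> \<longleftrightarrow> x = y"
proof
  assume 0: "x \<ominus>\<^bsub>H\<^esub> y = \<zero>\<^bsub>H\<^esub>"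
  have "x = (x \<ominus>\<^bsub>H\<^esub> y) \<oplus>\<^bsub>H\<^esub> y" using assms by (simp add: a_minus_def M.a_assoc M.l_neg)
  then show "x = y" using 0 assms by simp
qed (use assms in \<open>simp add: a_minus_def M.r_neg\<close>)

text \<open>Identities in the carrier are checked by pairing with all \<open>z\<close>, which turns
  module computations into arithmetic of complex numbers.\<close>

lemma cinner_ext:
  assumes "x \<in> carrier H" "y \<in> carrier H" "\<And>z. z \<in> carrier H \<Longrightarrow> cinner H x z = cinner H y z"
  shows "x = y"
proof -
  have "x \<ominus>\<^bsub>H\<^esub> y = \<zero>\<^bsub>H\<^esub>"
    using assms by (intro cinner_definite) (auto simp: cinner_diff_left)
  then show ?thesis using assms(1,2) diff_eq_zero_iff by blast
qed

lemma psd_on_cinner: "psd_on (carrier H) (cinner H)"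
  unfolding psd_on_def
proof (intro conjI ballI allI impI)
  fix n :: nat and t :: "nat \<Rightarrow> 'a" and c
  assume t: "\<forall>k<n. t k \<in> carrier H"
  define v where "v = (\<Oplus>\<^bsub>H\<^esub>k\<in>{..<n}. c k \<odot>\<^bsub>H\<^esub> t k)"
  have v: "v \<in> carrier H" unfolding v_def using t by (intro M.finsum_closed) auto
  have "cinner H v v = (\<Sum>k<n. cinner H (c k \<odot>\<^bsub>H\<^esub> t k) v)"
    by (subst (1) v_def, subst cinner_finsum_left) (use t v in auto)
  also have "\<dots> = (\<Sum>k<n. \<Sum>l<n. cinner H (c k \<odot>\<^bsub>H\<^esub> t k) (c l \<odot>\<^bsub>H\<^esub> t l))"
    unfolding v_def by (intro sum.cong refl, subst cinner_finsum_right) (use t in auto)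
  also have "\<dots> = (\<Sum>k<n. \<Sum>l<n. cinner H (t k) (t l) * c k * cnj (c l))"
    using t by (intro sum.cong refl) (simp add: cinner_smult_left cinner_smult_right mult_ac)
  finally show "0 \<le> Re (\<Sum>k<n. \<Sum>l<n. cinner H (t k) (t l) * c k * cnj (c l))"
    using cinner_nonneg[OF v] by simp
qed (rule cinner_commute)

lemma hnorm_nonneg: "x \<in> carrier H \<Longrightarrow> 0 \<le> hnorm H x"
  by (simp add: hnorm_def cinner_nonneg)

lemma hnorm_square: "x \<in> carrier H \<Longrightarrow> (hnorm H x)\<^sup>2 = Re (cinner H x x)"
  by (simp add: hnorm_def cinner_nonneg)

lemma cinner_self: "x \<in> carrier H \<Longrightarrow> cinner H x x = complex_of_real ((hnorm H x)\<^sup>2)"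
  using psd_on_diag(2)[OF psd_on_cinner] by (simp add: hnorm_square del: of_real_power)

lemma hnorm_eq_0: "x \<in> carrier H \<Longrightarrow> hnorm H x = 0 \<Longrightarrow> x = \<zero>\<^bsub>H\<^esub>"
  by (rule cinner_definite) (simp_all add: cinner_self)

lemma hnorm_zero: "hnorm H \<zero>\<^bsub>H\<^esub> = 0"
  by (simp add: hnorm_def cinner_zero_left)

lemma hnorm_smult: "x \<in> carrier H \<Longrightarrow> hnorm H (c \<odot>\<^bsub>H\<^esub> x) = cmod c * hnorm H x"
proof -
  assume x: "x \<in> carrier H"
  have "cinner H (c \<odot>\<^bsub>H\<^esub> x) (c \<odot>\<^bsub>H\<^esub> x) = (c * cnj c) * cinner H x x"
    using x by (simp add: cinner_smult_left cinner_smult_right)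
  also have "\<dots> = complex_of_real ((cmod c * hnorm H x)\<^sup>2)"
    unfolding complex_norm_square[symmetric] cinner_self[OF x] by (simp add: power_mult_distrib)
  finally show ?thesis
    using hnorm_nonneg[OF x] by (simp add: hnorm_def del: of_real_power)
qed

lemma cinner_bound:
  assumes "x \<in> carrier H" "y \<in> carrier H"
  shows "cmod (cinner H x y) \<le> hnorm H x * hnorm H y"
proof (rule power2_le_imp_le)
  show "(cmod (cinner H x y))\<^sup>2 \<le> (hnorm H x * hnorm H y)\<^sup>2"
    using psd_on_Cauchy_Schwarz[OF psd_on_cinner assms]
    by (simp add: power_mult_distrib hnorm_square assms)
qed (simp add: hnorm_nonneg assms)

lemma hnorm_triangle:
  assumes x: "x \<in> carrier H" and y: "y \<in> carrier H"
  shows "hnorm H (x \<oplus>\<^bsub>H\<^esub> y) \<le> hnorm H x + hnorm H y"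
proof (rule power2_le_imp_le)
  have "(hnorm H (x \<oplus>\<^bsub>H\<^esub> y))\<^sup>2 = Re (cinner H x x) + Re (cinner H y y) + Re (cinner H x y) + Re (cinner H y x)"
    using x y by (simp add: hnorm_square cinner_add_left cinner_add_right)
  also have "Re (cinner H x y) \<le> hnorm H x * hnorm H y"
    using complex_Re_le_cmod cinner_bound[OF x y] by (rule order_trans)
  also have "Re (cinner H y x) \<le> hnorm H y * hnorm H x"
    using complex_Re_le_cmod cinner_bound[OF y x] by (rule order_trans)
  finally show "(hnorm H (x \<oplus>\<^bsub>H\<^esub> y))\<^sup>2 \<le> (hnorm H x + hnorm H y)\<^sup>2"
    using x y by (simp add: hnorm_square[symmetric] power2_sum algebra_simps)
qed (simp add: hnorm_nonneg assms)

text \<open>The value off the carrier is fixed because \<open>Metric_space\<close> asks for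
  nonnegativity and symmetry on the whole type.\<close>

definition hdist :: "'a \<Rightarrow> 'a \<Rightarrow> real" where
  "hdist x y = (if x \<in> carrier H \<and> y \<in> carrier H then hnorm H (x \<ominus>\<^bsub>H\<^esub> y) else 0)"

lemma hdist_eq: "x \<in> carrier H \<Longrightarrow> y \<in> carrier H \<Longrightarrow> hdist x y = hnorm H (x \<ominus>\<^bsub>H\<^esub> y)"
  by (simp add: hdist_def)

sublocale HM: Metric_space "carrier H" hdist
proof
  show "0 \<le> hdist x y" for x y by (simp add: hdist_def hnorm_nonneg)
  show "hdist x y = hdist y x" for x y
  proof (cases "x \<in> carrier H \<and> y \<in> carrier H")
    case True
    then have "x \<ominus>\<^bsub>H\<^esub> y = (-1) \<odot>\<^bsub>H\<^esub> (y \<ominus>\<^bsub>H\<^esub> x)"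
      by (intro cinner_ext) (auto simp: cinner_diff_left cinner_smult_left)
    then show ?thesis using True by (simp add: hdist_def hnorm_smult)
  qed (auto simp: hdist_def)
  show "hdist x y = 0 \<longleftrightarrow> x = y" if "x \<in> carrier H" "y \<in> carrier H" for x y
  proof -
    have "hnorm H (x \<ominus>\<^bsub>H\<^esub> y) = 0 \<longleftrightarrow> x \<ominus>\<^bsub>H\<^esub> y = \<zero>\<^bsub>H\<^esub>"
      using that hnorm_eq_0 hnorm_zero M.minus_closed by metis
    then show ?thesis using that diff_eq_zero_iff by (simp add: hdist_eq)
  qed
  show "hdist x z \<le> hdist x y + hdist y z" if "x \<in> carrier H" "y \<in> carrier H" "z \<in> carrier H" for x y z
  proof -
    have "x \<ominus>\<^bsub>H\<^esub> z = (x \<ominus>\<^bsub>H\<^esub> y) \<oplus>\<^bsub>H\<^esub> (y \<ominus>\<^bsub>H\<^esub> z)"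
      using that by (intro cinner_ext) (auto simp: cinner_diff_left cinner_add_left)
    then show ?thesis using that by (simp add: hdist_eq hnorm_triangle)
  qed
qed

lemma mcomplete_hdist: "HM.mcomplete"
  unfolding HM.mcomplete_def
proof (intro allI impI)
  fix s assume "HM.MCauchy s"
  then have s: "\<And>n. s n \<in> carrier H"
    and c: "\<And>\<epsilon>. 0 < \<epsilon> \<Longrightarrow> \<exists>N. \<forall>m\<ge>N. \<forall>n\<ge>N. hnorm H (s m \<ominus>\<^bsub>H\<^esub> s n) < \<epsilon>"
    unfolding HM.MCauchy_def by (auto simp: hdist_def image_subset_iff)
  from complete[of s, OF s c] obtain x where x: "x \<in> carrier H" "(\<lambda>n. hnorm H (s n \<ominus>\<^bsub>H\<^esub> x)) \<longlonglongrightarrow> 0"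
    by blast
  then have "(\<lambda>n. hdist (s n) x) \<longlonglongrightarrow> 0" by (simp add: hdist_eq s)
  then show "\<exists>x. limitin HM.mtopology s x sequentially"
    using x(1) s HM.limit_metric_sequentially[of s x] unfolding LIMSEQ_def
    by (intro exI[of _ x]) (auto simp: HM.limit_metric_sequentially)
qed

text \<open>Solving \<open>y = c x - N x\<close> means finding a fixed point of
  \<open>x \<mapsto> (y + N x) / c\<close>, a contraction with constant
  \<open>\<rho> / cmod c\<close>. Banach's theorem thus takes the place of a Neumann series.\<close>

lemma bij_betw_scalar_minus_contraction:
  assumes N: "\<And>x. x \<in> carrier H \<Longrightarrow> N x \<in> carrier H"
    and sub: "\<And>x y. x \<in> carrier H \<Longrightarrow> y \<in> carrier H \<Longrightarrow> hnorm H (N x \<ominus>\<^bsub>H\<^esub> N y) \<le> \<rho> * hnorm H (x \<ominus>\<^bsub>H\<^esub> y)"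
    and \<rho>: "\<rho> < cmod c" and \<rho>0: "0 \<le> \<rho>"
  shows "bij_betw (\<lambda>x. c \<odot>\<^bsub>H\<^esub> x \<ominus>\<^bsub>H\<^esub> N x) (carrier H) (carrier H)"
proof -
  have c: "c \<noteq> 0" using \<rho> \<rho>0 by auto
  have fixp: "y = c \<odot>\<^bsub>H\<^esub> x \<ominus>\<^bsub>H\<^esub> N x \<longleftrightarrow> (1 / c) \<odot>\<^bsub>H\<^esub> (y \<oplus>\<^bsub>H\<^esub> N x) = x"
    if "x \<in> carrier H" "y \<in> carrier H" for x y
  proof
    assume y: "y = c \<odot>\<^bsub>H\<^esub> x \<ominus>\<^bsub>H\<^esub> N x"
    show "(1 / c) \<odot>\<^bsub>H\<^esub> (y \<oplus>\<^bsub>H\<^esub> N x) = x"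
      by (rule cinner_ext) (use that N c in \<open>auto simp: cinner_add_left cinner_smult_left cinner_diff_left y\<close>)
  next
    assume x: "(1 / c) \<odot>\<^bsub>H\<^esub> (y \<oplus>\<^bsub>H\<^esub> N x) = x"
    have "cinner H y z = cinner H (c \<odot>\<^bsub>H\<^esub> x \<ominus>\<^bsub>H\<^esub> N x) z" if z: "z \<in> carrier H" for z
    proof -
      have "cinner H x z = (1 / c) * (cinner H y z + cinner H (N x) z)"
        by (subst x[symmetric]) (use that z \<open>x \<in> _\<close> \<open>y \<in> _\<close> N in \<open>simp add: cinner_add_left cinner_smult_left\<close>)
      then show ?thesis using z \<open>x \<in> _\<close> \<open>y \<in> _\<close> N c
        by (simp add: cinner_add_left cinner_smult_left cinner_diff_left field_simps)
    qed
    then show "y = c \<odot>\<^bsub>H\<^esub> x \<ominus>\<^bsub>H\<^esub> N x" by (intro cinner_ext) (use that N in auto)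
  qed
  have ex1: "\<exists>!x. x \<in> carrier H \<and> (1 / c) \<odot>\<^bsub>H\<^esub> (y \<oplus>\<^bsub>H\<^esub> N x) = x" if y: "y \<in> carrier H" for y
  proof -
    define f where "f = (\<lambda>x. (1 / c) \<odot>\<^bsub>H\<^esub> (y \<oplus>\<^bsub>H\<^esub> N x))"
    have f: "f \<in> carrier H \<rightarrow> carrier H" using y N by (auto simp: f_def)
    have con: "hdist (f x) (f x') \<le> \<rho> / cmod c * hdist x x'" if "x \<in> carrier H" "x' \<in> carrier H" for x x'
    proof -
      have "f x \<ominus>\<^bsub>H\<^esub> f x' = (1 / c) \<odot>\<^bsub>H\<^esub> (N x \<ominus>\<^bsub>H\<^esub> N x')"
        by (rule cinner_ext)
           (use that y N in \<open>auto simp: f_def cinner_add_left cinner_smult_left cinner_diff_left algebra_simps\<close>)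
      then have "hdist (f x) (f x') = hnorm H (N x \<ominus>\<^bsub>H\<^esub> N x') / cmod c"
        using that f N by (simp add: hdist_eq Pi_iff hnorm_smult norm_divide)
      also have "\<dots> \<le> \<rho> * hnorm H (x \<ominus>\<^bsub>H\<^esub> x') / cmod c"
        by (intro divide_right_mono sub that) simp
      finally show ?thesis using that by (simp add: hdist_eq)
    qed
    have lt: "\<rho> / cmod c < 1" using \<rho> c by simp
    have ne: "carrier H \<noteq> {}" using y by blast
    obtain x where x: "x \<in> carrier H" "f x = x"
      by (rule HM.Banach_fixedpoint_thm[OF mcomplete_hdist ne f lt con]) blast+
    have "x' = x" if "x' \<in> carrier H" "f x' = x'" for x'
    proof (rule ccontr)
      assume "x' \<noteq> x"
      then have "0 < hdist x' x" using that x HM.mdist_pos_eq by auto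
      then have "\<rho> / cmod c * hdist x' x < 1 * hdist x' x" using lt by (intro mult_strict_right_mono)
      then show False using con[OF that(1) x(1)] that x by simp
    qed
    then show ?thesis using x unfolding f_def by blast
  qed
  show ?thesis
    unfolding bij_betw_def
  proof
    show "inj_on (\<lambda>x. c \<odot>\<^bsub>H\<^esub> x \<ominus>\<^bsub>H\<^esub> N x) (carrier H)"
    proof (rule inj_onI)
      fix x x' assume xx: "x \<in> carrier H" "x' \<in> carrier H" and eq: "c \<odot>\<^bsub>H\<^esub> x \<ominus>\<^bsub>H\<^esub> N x = c \<odot>\<^bsub>H\<^esub> x' \<ominus>\<^bsub>H\<^esub> N x'"
      have "c \<odot>\<^bsub>H\<^esub> x \<ominus>\<^bsub>H\<^esub> N x \<in> carrier H" using xx N by auto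
      from ex1[OF this] fixp[OF xx(1) this] fixp[OF xx(2) this] eq xx show "x = x'" by blast
    qed
    have "y \<in> (\<lambda>x. c \<odot>\<^bsub>H\<^esub> x \<ominus>\<^bsub>H\<^esub> N x) ` carrier H" if y: "y \<in> carrier H" for y
      using ex1[OF y] fixp y by blast
    then show "(\<lambda>x. c \<odot>\<^bsub>H\<^esub> x \<ominus>\<^bsub>H\<^esub> N x) ` carrier H = carrier H" using N by auto
  qed
qed

section \<open>Orthonormal bases of finite dimensional spaces\<close>

definition orthonormal_family :: "nat \<Rightarrow> (nat \<Rightarrow> 'a) \<Rightarrow> bool" where
  "orthonormal_family m u \<longleftrightarrow> (\<forall>i<m. u i \<in> carrier H) \<and>
     (\<forall>i<m. \<forall>j<m. cinner H (u i) (u j) = (if i = j then 1 else 0))"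

text \<open>Weak form of \<open>x\<close> being in the span of \<open>u\<close>, which avoids sums in the carrier.\<close>

definition expands :: "nat \<Rightarrow> (nat \<Rightarrow> 'a) \<Rightarrow> 'a \<Rightarrow> bool" where
  "expands m u x \<longleftrightarrow> (\<forall>z\<in>carrier H. cinner H x z = (\<Sum>i<m. cinner H x (u i) * cinner H (u i) z))"

text \<open>Induction on \<open>B\<close>: the component \<open>w\<close> of the new vector
  orthogonal to \<open>u\<close> is normalized and appended unless it is zero. Vectors already
  expanded are orthogonal to \<open>w\<close>, so their expansions gain only a zero term.\<close>

lemma gram_schmidt:
  assumes "finite B" "B \<subseteq> carrier H"
  shows "\<exists>m u. orthonormal_family m u \<and> (\<forall>b\<in>B. expands m u b)"
  using assms
proof (induction B)
  case empty
  show ?case by (rule exI[of _ 0]) (simp add: orthonormal_family_def)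
next
  case (insert b B)
  then obtain m u where u: "orthonormal_family m u" and B: "\<forall>x\<in>B. expands m u x" by auto
  have b: "b \<in> carrier H" and Bc: "B \<subseteq> carrier H" using insert.prems by auto
  have uc: "u i \<in> carrier H" if "i < m" for i using u that by (auto simp: orthonormal_family_def)
  define p where "p = (\<Oplus>\<^bsub>H\<^esub>i\<in>{..<m}. cinner H b (u i) \<odot>\<^bsub>H\<^esub> u i)"
  have p: "p \<in> carrier H" unfolding p_def using uc by (intro M.finsum_closed) auto
  have ip_p: "cinner H p z = (\<Sum>i<m. cinner H b (u i) * cinner H (u i) z)" if "z \<in> carrier H" for z
    unfolding p_def by (subst cinner_finsum_left) (use uc that in \<open>auto simp: cinner_smult_left\<close>)
  define w where "w = b \<ominus>\<^bsub>H\<^esub> p"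
  have w: "w \<in> carrier H" using b p by (auto simp: w_def)
  have bz: "cinner H b z = cinner H w z + (\<Sum>i<m. cinner H b (u i) * cinner H (u i) z)" if "z \<in> carrier H" for z
    using that b p by (simp add: w_def cinner_diff_left ip_p)
  have wu: "cinner H w (u j) = 0" if "j < m" for j
  proof -
    have "(\<Sum>i<m. cinner H b (u i) * cinner H (u i) (u j)) = (\<Sum>i<m. if i = j then cinner H b (u i) else 0)"
      using u that by (intro sum.cong) (auto simp: orthonormal_family_def)
    then show ?thesis using bz[OF uc[OF that]] that by simp
  qed
  have uw: "cinner H (u j) w = 0" if "j < m" for j
    using wu[OF that] cinner_commute[OF uc[OF that] w] by simp
  show ?case
  proof (cases "hnorm H w = 0")
    case True
    then have "w = \<zero>\<^bsub>H\<^esub>" using hnorm_eq_0 w by blast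
    then have "expands m u b" using bz cinner_zero_left by (simp add: expands_def)
    then show ?thesis using u B by blast
  next
    case False
    define n where "n = hnorm H w"
    define v where "v = complex_of_real (1 / n) \<odot>\<^bsub>H\<^esub> w"
    define u' where "u' = u(m := v)"
    have n: "0 < n" using False hnorm_nonneg[OF w] by (simp add: n_def)
    have ww: "cinner H w w = complex_of_real (n * n)" using cinner_self[OF w] by (simp add: n_def power2_eq_square)
    have v: "v \<in> carrier H" using w by (auto simp: v_def)
    have vv: "cinner H v v = 1"
      using w n by (simp add: v_def cinner_smult_left cinner_smult_right ww)
    have vu: "cinner H v (u j) = 0" "cinner H (u j) v = 0" if "j < m" for j
      using w uc[OF that] by (simp_all add: v_def cinner_smult_left cinner_smult_right wu uw that)
    have on: "orthonormal_family (Suc m) u'"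
      using u v vv vu by (auto simp: orthonormal_family_def u'_def less_Suc_eq)
    have "expands (Suc m) u' x" if "x \<in> B" for x
    proof -
      have x: "x \<in> carrier H" and ex: "expands m u x" using that Bc B by auto
      have "cinner H x w = 0" using ex w by (simp add: expands_def uw)
      then have "cinner H x v = 0" using x w by (simp add: v_def cinner_smult_right)
      then show ?thesis using ex by (simp add: expands_def u'_def)
    qed
    moreover have "expands (Suc m) u' b"
    proof -
      have "cinner H b v * cinner H v z = cinner H w z" if z: "z \<in> carrier H" for z
        using w b z n bz[OF w] by (simp add: v_def cinner_smult_left cinner_smult_right uw ww)
      then show ?thesis using bz by (simp add: expands_def u'_def)
    qed
    ultimately show ?thesis using on by blast
  qed
qed

lemma finite_dimensional_orthonormal_basis:
  assumes "finite_dimensional H"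
  obtains m :: nat and u where "\<And>i. i < m \<Longrightarrow> u i \<in> carrier H"
    and "\<And>i j. i < m \<Longrightarrow> j < m \<Longrightarrow> cinner H (u i) (u j) = (if i = j then 1 else 0)"
    and "\<And>x z. x \<in> carrier H \<Longrightarrow> z \<in> carrier H \<Longrightarrow>
      cinner H x z = (\<Sum>i<m. cinner H x (u i) * cinner H (u i) z)"
proof -
  obtain B where B: "finite B" "B \<subseteq> carrier H"
    and span: "\<And>x. x \<in> carrier H \<Longrightarrow> \<exists>c. x = (\<Oplus>\<^bsub>H\<^esub>b\<in>B. c b \<odot>\<^bsub>H\<^esub> b)"
    using assms unfolding finite_dimensional_def by blast
  obtain m u where u: "orthonormal_family m u" and ex: "\<forall>b\<in>B. expands m u b"
    using gram_schmidt[OF B] by blast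
  have uc: "u i \<in> carrier H" if "i < m" for i using u that by (auto simp: orthonormal_family_def)
  show ?thesis
  proof (rule that[of m u])
    show "cinner H x z = (\<Sum>i<m. cinner H x (u i) * cinner H (u i) z)"
      if x: "x \<in> carrier H" and z: "z \<in> carrier H" for x z
    proof -
      obtain c where c: "x = (\<Oplus>\<^bsub>H\<^esub>b\<in>B. c b \<odot>\<^bsub>H\<^esub> b)" using span[OF x] by blast
      have xz: "cinner H x z = (\<Sum>b\<in>B. c b * cinner H b z)" if "z \<in> carrier H" for z
        unfolding c by (subst cinner_finsum_left) (use B that in \<open>auto intro!: sum.cong simp: cinner_smult_left subset_iff\<close>)
      have "cinner H x z = (\<Sum>b\<in>B. c b * (\<Sum>i<m. cinner H b (u i) * cinner H (u i) z))"
        unfolding xz[OF z] using ex z by (intro sum.cong refl) (auto simp: expands_def)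
      also have "\<dots> = (\<Sum>i<m. (\<Sum>b\<in>B. c b * cinner H b (u i)) * cinner H (u i) z)"
        by (simp add: sum_distrib_left sum_distrib_right mult.assoc sum.swap[of _ B])
      finally show ?thesis by (simp add: xz uc)
    qed
  qed (use u in \<open>auto simp: orthonormal_family_def\<close>)
qed

end

text \<open>Entries are bounded by the norm, so pointwise limits exist. The Cauchy estimate passes
  to the limit on each finite set with a bound independent of the set, which controls
  \<open>s n - a\<close> in norm.\<close>

lemma ell2_complete:
  fixes s :: "nat \<Rightarrow> 'i \<Rightarrow> complex"
  assumes s: "\<And>n. ell2 (s n)"
    and cauchy: "\<And>\<epsilon>. 0 < \<epsilon> \<Longrightarrow> \<exists>N. \<forall>m\<ge>N. \<forall>n\<ge>N. kernel_dist2 ip (s m) (s n) < \<epsilon>"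
  obtains a where "ell2 a" "(\<lambda>n. kernel_dist2 ip (s n) a) \<longlonglongrightarrow> 0" "\<And>i. (\<lambda>n. s n i) \<longlonglongrightarrow> a i"
proof -
  have "Cauchy (\<lambda>n. s n i)" for i
  proof (rule CauchyI)
    fix e :: real assume e: "0 < e"
    obtain N where N: "\<And>m n. m \<ge> N \<Longrightarrow> n \<ge> N \<Longrightarrow> kernel_dist2 ip (s m) (s n) < e\<^sup>2"
      using cauchy[of "e\<^sup>2"] e by auto
    show "\<exists>M. \<forall>m\<ge>M. \<forall>n\<ge>M. norm (s m i - s n i) < e"
    proof (intro exI allI impI)
      fix m n assume "N \<le> m" "N \<le> n"
      then have "(cmod (s m i - s n i))\<^sup>2 < e\<^sup>2"
        using ell2_component_le[OF ell2_diff[OF s[of m] s[of n]], of i] N[of m n] by (simp add: kernel_dist2_ip s)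
      then show "norm (s m i - s n i) < e" using e by (simp add: power2_less_imp_less)
    qed
  qed
  then have "\<exists>l. (\<lambda>n. s n i) \<longlonglongrightarrow> l" for i by (simp add: Cauchy_convergent_iff convergent_def)
  then obtain a where a: "\<And>i. (\<lambda>n. s n i) \<longlonglongrightarrow> a i" by metis
  have near: "\<exists>N. \<forall>n\<ge>N. ell2 (\<lambda>i. s n i - a i) \<and> Re (ip (\<lambda>i. s n i - a i) (\<lambda>i. s n i - a i)) \<le> e" if e0: "0 < e" for e
  proof -
    obtain N where N: "\<And>m n. m \<ge> N \<Longrightarrow> n \<ge> N \<Longrightarrow> kernel_dist2 ip (s m) (s n) < e"
      using cauchy[OF e0] by auto
    have le: "(\<Sum>i\<in>F. (cmod (s n i - a i))\<^sup>2) \<le> e" if "n \<ge> N" "finite F" for n F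
    proof (rule LIMSEQ_le_const2)
      show "(\<lambda>m. \<Sum>i\<in>F. (cmod (s n i - s m i))\<^sup>2) \<longlonglongrightarrow> (\<Sum>i\<in>F. (cmod (s n i - a i))\<^sup>2)"
        by (intro tendsto_intros a)
      have "(\<Sum>i\<in>F. (cmod (s n i - s m i))\<^sup>2) \<le> e" if "m \<ge> N" for m
        using ip_self_finite_le[OF ell2_diff[OF s[of n] s[of m]] \<open>finite F\<close>] N[OF \<open>n \<ge> N\<close> that]
        by (simp add: kernel_dist2_ip s)
      then show "\<exists>N. \<forall>m\<ge>N. (\<Sum>i\<in>F. (cmod (s n i - s m i))\<^sup>2) \<le> e" by blast
    qed
    have "ell2 (\<lambda>i. s n i - a i) \<and> Re (ip (\<lambda>i. s n i - a i) (\<lambda>i. s n i - a i)) \<le> e" if "n \<ge> N" for n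
      using ell2_bounded[of "\<lambda>i. s n i - a i" e] le[OF that] by blast
    then show ?thesis by blast
  qed
  from near[of 1] obtain N where "ell2 (\<lambda>i. s N i - a i)" by auto
  from ell2_diff[OF s[of N] this] have ea: "ell2 a" by simp
  show ?thesis
  proof (rule that[OF ea _ a], rule LIMSEQ_I)
    fix e :: real assume "0 < e"
    with near[of "e / 2"] obtain N where N: "\<And>n. n \<ge> N \<Longrightarrow> Re (ip (\<lambda>i. s n i - a i) (\<lambda>i. s n i - a i)) \<le> e / 2"
      by auto
    show "\<exists>no. \<forall>n\<ge>no. norm (kernel_dist2 ip (s n) a - 0) < e"
    proof (intro exI allI impI)
      fix n assume "N \<le> n"
      from N[OF this] ip_self_nonneg[OF ell2_diff[OF s[of n] ea]] \<open>0 < e\<close>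
      show "norm (kernel_dist2 ip (s n) a - 0) < e" by (simp add: kernel_dist2_ip s ea)
    qed
  qed
qed

section \<open>Sequence spaces and their tensor products\<close>

text \<open>\<open>mult\<close> and \<open>one\<close> are fillers for the ring fields of the record.\<close>

definition seq_space :: "((nat \<Rightarrow> complex) \<Rightarrow> 'k) \<Rightarrow> nat set \<Rightarrow> 'k inner_module" where
  "seq_space emb S =
    \<lparr>carrier = emb ` {a. ell2 a \<and> (\<forall>i. i \<notin> S \<longrightarrow> a i = 0)},
     mult = (\<lambda>x y. x),
     one = emb (\<lambda>_. 0),
     zero = emb (\<lambda>_. 0),
     add = (\<lambda>x y. emb (\<lambda>i. inv_into UNIV emb x i + inv_into UNIV emb y i)),
     smult = (\<lambda>c x. emb (\<lambda>i. c * inv_into UNIV emb x i)),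
     cinner = (\<lambda>x y. ip (inv_into UNIV emb x) (inv_into UNIV emb y))\<rparr>"

locale sequence_embedding =
  fixes emb :: "(nat \<Rightarrow> complex) \<Rightarrow> 'k"
  assumes inj_emb: "inj emb"
begin

abbreviation dec :: "'k \<Rightarrow> nat \<Rightarrow> complex" where
  "dec \<equiv> inv_into UNIV emb"

text \<open>All auxiliary spaces are cut out of one copy of the sequences: \<open>UNIV\<close> gives
  the state space, \<open>tensor_supp\<close> the tensor product, and \<open>{}\<close> the zero
  space that serves as trivial enlargement of \<open>K2\<close>.\<close>

abbreviation E :: "nat set \<Rightarrow> 'k inner_module" where
  "E \<equiv> seq_space emb"

lemma dec_emb [simp]: "dec (emb a) = a"
  by (simp add: inj_emb)

lemma emb_in_iff: "emb a \<in> carrier (E S) \<longleftrightarrow> ell2 a \<and> (\<forall>i. i \<notin> S \<longrightarrow> a i = 0)"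
  using inj_emb by (auto simp: seq_space_def dest: injD)

lemma in_E:
  assumes "x \<in> carrier (E S)"
  shows "emb (dec x) = x" "ell2 (dec x)" "i \<notin> S \<Longrightarrow> dec x i = 0"
  using assms by (auto simp: seq_space_def)

lemma E_sel:
  "\<zero>\<^bsub>E S\<^esub> = emb (\<lambda>_. 0)"
  "x \<oplus>\<^bsub>E S\<^esub> y = emb (\<lambda>i. dec x i + dec y i)"
  "c \<odot>\<^bsub>E S\<^esub> x = emb (\<lambda>i. c * dec x i)"
  "cinner (E S) x y = ip (dec x) (dec y)"
  by (simp_all add: seq_space_def)

lemma E_eqI: "x \<in> carrier (E S) \<Longrightarrow> y \<in> carrier (E S) \<Longrightarrow> (\<And>i. dec x i = dec y i) \<Longrightarrow> x = y"
  using in_E(1) by (metis ext)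

lemma module_E: "module complex_scalars (E S)"
proof (rule moduleI)
  show "cring complex_scalars" by (rule cring_from_type_algebra)
  show "abelian_group (E S)"
  proof (rule abelian_groupI)
    fix x assume x: "x \<in> carrier (E S)"
    show "\<exists>y\<in>carrier (E S). y \<oplus>\<^bsub>E S\<^esub> x = \<zero>\<^bsub>E S\<^esub>"
    proof (rule bexI[of _ "emb (\<lambda>i. -1 * dec x i)"])
      show "emb (\<lambda>i. -1 * dec x i) \<in> carrier (E S)"
        unfolding emb_in_iff using ell2_scale[OF in_E(2)[OF x], of "-1"] in_E(3)[OF x] by auto
    qed (simp add: E_sel)
    show "\<zero>\<^bsub>E S\<^esub> \<oplus>\<^bsub>E S\<^esub> x = x" using in_E(1)[OF x] by (simp add: E_sel)
  qed (auto simp: E_sel emb_in_iff in_E ell2_add algebra_simps)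
qed (auto simp: E_sel emb_in_iff in_E ell2_scale algebra_simps)

lemma E_diff:
  assumes x: "x \<in> carrier (E S)" and y: "y \<in> carrier (E S)"
  shows "x \<ominus>\<^bsub>E S\<^esub> y = emb (\<lambda>i. dec x i - dec y i)"
proof -
  interpret module complex_scalars "E S" by (rule module_E)
  have "emb (\<lambda>i. - dec y i) \<in> carrier (E S)"
    unfolding emb_in_iff using ell2_scale[OF in_E(2)[OF y], of "-1"] in_E(3)[OF y] by auto
  then have "\<ominus>\<^bsub>E S\<^esub> y = emb (\<lambda>i. - dec y i)"
    using y by (intro M.minus_equality) (simp_all add: E_sel)
  then show ?thesis by (simp add: a_minus_def E_sel)
qed

lemma hnorm_E: "hnorm (E S) x = sqrt (Re (ip (dec x) (dec x)))"
  by (simp add: hnorm_def E_sel)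

lemma hnorm_E_diff:
  "x \<in> carrier (E S) \<Longrightarrow> y \<in> carrier (E S) \<Longrightarrow>
    hnorm (E S) (x \<ominus>\<^bsub>E S\<^esub> y) = sqrt (kernel_dist2 ip (dec x) (dec y))"
  by (simp add: hnorm_E E_diff kernel_dist2_ip in_E(2))

lemma hilbert_E: "complex_hilbert_space (E S)"
proof (intro complex_hilbert_space.intro module_E complex_hilbert_space_axioms.intro)
  fix x y z c assume x: "x \<in> carrier (E S)" and z: "z \<in> carrier (E S)"
  show "cinner (E S) (c \<odot>\<^bsub>E S\<^esub> x) z = c * cinner (E S) x z"
    by (simp add: E_sel ip_scale_left)
  show "cinner (E S) x z = cnj (cinner (E S) z x)" unfolding E_sel by (rule ip_commute)
  show "0 \<le> Re (cinner (E S) x x)" using x by (simp add: E_sel ip_self_nonneg in_E(2))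
  show "x = \<zero>\<^bsub>E S\<^esub>" if "cinner (E S) x x = 0"
  proof -
    have "dec x = (\<lambda>_. 0)" using that ip_definite[OF in_E(2)[OF x]] by (auto simp: E_sel)
    then show ?thesis using in_E(1)[OF x] by (simp add: E_sel)
  qed
  show "cinner (E S) (x \<oplus>\<^bsub>E S\<^esub> y) z = cinner (E S) x z + cinner (E S) y z" if "y \<in> carrier (E S)"
    using x z that by (simp add: E_sel ip_add_left in_E(2))
next
  fix s :: "nat \<Rightarrow> 'k"
  assume s: "\<And>n. s n \<in> carrier (E S)"
    and c: "\<And>\<epsilon>. 0 < \<epsilon> \<Longrightarrow> \<exists>N. \<forall>m\<ge>N. \<forall>n\<ge>N. hnorm (E S) (s m \<ominus>\<^bsub>E S\<^esub> s n) < \<epsilon>"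
  have cs: "\<exists>N. \<forall>m\<ge>N. \<forall>n\<ge>N. kernel_dist2 ip (dec (s m)) (dec (s n)) < e" if "0 < e" for e
    using c[of "sqrt e"] that by (simp add: hnorm_E_diff s)
  have "\<exists>a. ell2 a \<and> (\<lambda>n. kernel_dist2 ip (dec (s n)) a) \<longlonglongrightarrow> 0 \<and> (\<forall>i. (\<lambda>n. dec (s n) i) \<longlonglongrightarrow> a i)"
    by (rule ell2_complete[of "\<lambda>n. dec (s n)", OF in_E(2)[OF s] cs]) auto
  then obtain a where a: "ell2 a" "(\<lambda>n. kernel_dist2 ip (dec (s n)) a) \<longlonglongrightarrow> 0" "\<And>i. (\<lambda>n. dec (s n) i) \<longlonglongrightarrow> a i"
    by blast
  have "a i = 0" if "i \<notin> S" for i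
  proof -
    have "(\<lambda>n. dec (s n) i) = (\<lambda>_. 0)" using in_E(3)[OF s that] by simp
    with a(3)[of i] show ?thesis using LIMSEQ_unique tendsto_const by metis
  qed
  then have ea: "emb a \<in> carrier (E S)" using a(1) by (simp add: emb_in_iff)
  have "(\<lambda>n. sqrt (kernel_dist2 ip (dec (s n)) a)) \<longlonglongrightarrow> sqrt 0" by (intro tendsto_intros a)
  then have "(\<lambda>n. hnorm (E S) (s n \<ominus>\<^bsub>E S\<^esub> emb a)) \<longlonglongrightarrow> 0" by (simp add: hnorm_E_diff s ea)
  with ea show "\<exists>x\<in>carrier (E S). (\<lambda>n. hnorm (E S) (s n \<ominus>\<^bsub>E S\<^esub> x)) \<longlonglongrightarrow> 0" by blast
qed

lemma E_empty:
  shows "carrier (E {}) = {\<zero>\<^bsub>E {}\<^esub>}" and "finite_dimensional (E {})"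
proof -
  interpret complex_hilbert_space "E {}" by (rule hilbert_E)
  have "{a. ell2 a \<and> (\<forall>i. i \<notin> {} \<longrightarrow> a i = 0)} = {\<lambda>_::nat. 0}" by (auto simp: fun_eq_iff)
  then show 1: "carrier (E {}) = {\<zero>\<^bsub>E {}\<^esub>}" by (simp add: seq_space_def)
  show "finite_dimensional (E {})"
    unfolding finite_dimensional_def by (rule exI[of _ "{}"]) (simp add: 1)
qed

lemma dec_finsum:
  assumes "finite A" "\<And>a. a \<in> A \<Longrightarrow> f a \<in> carrier (E S)"
  shows "dec (\<Oplus>\<^bsub>E S\<^esub>a\<in>A. f a) i = (\<Sum>a\<in>A. dec (f a) i)"
proof -
  interpret module complex_scalars "E S" by (rule module_E)
  show ?thesis using assms
  proof (induction A)
    case empty then show ?case by (simp add: E_sel)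
  next
    case (insert a A)
    then have "f \<in> A \<rightarrow> carrier (E S)" by auto
    with insert show ?case by (simp add: E_sel)
  qed
qed

end

section \<open>Coordinates with respect to an orthonormal basis\<close>

locale onb_space = complex_hilbert_space H for H :: "'a inner_module" (structure) +
  fixes m :: nat and u :: "nat \<Rightarrow> 'a"
  assumes u_in: "i < m \<Longrightarrow> u i \<in> carrier H"
    and u_ip: "i < m \<Longrightarrow> j < m \<Longrightarrow> cinner H (u i) (u j) = (if i = j then 1 else 0)"
    and u_expand: "x \<in> carrier H \<Longrightarrow> z \<in> carrier H \<Longrightarrow>
      cinner H x z = (\<Sum>i<m. cinner H x (u i) * cinner H (u i) z)"
begin

definition coord :: "'a \<Rightarrow> nat \<Rightarrow> complex" where
  "coord x i = (if i < m then cinner H x (u i) else 0)"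

definition comb :: "(nat \<Rightarrow> complex) \<Rightarrow> 'a" where
  "comb a = (\<Oplus>\<^bsub>H\<^esub>i\<in>{..<m}. a i \<odot>\<^bsub>H\<^esub> u i)"

lemma ell2_coord: "ell2 (coord x)"
  by (rule ell2_finite_support[of "{..<m}"]) (auto simp: coord_def)

lemma ip_coord:
  assumes "x \<in> carrier H" "y \<in> carrier H"
  shows "ip (coord x) (coord y) = cinner H x y"
proof -
  have "ip (coord x) (coord y) = (\<Sum>i\<in>{..<m}. coord x i * cnj (coord y i))"
    by (rule ell2_finite_support) (auto simp: coord_def)
  also have "\<dots> = (\<Sum>i<m. cinner H x (u i) * cinner H (u i) y)"
    using assms(2) u_in by (intro sum.cong refl) (simp add: coord_def cinner_commute[of "u _" y])
  finally show ?thesis using u_expand[OF assms] by simp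
qed

lemma coord_add: "x \<in> carrier H \<Longrightarrow> y \<in> carrier H \<Longrightarrow> coord (x \<oplus>\<^bsub>H\<^esub> y) i = coord x i + coord y i"
  by (simp add: coord_def cinner_add_left u_in)

lemma coord_smult: "x \<in> carrier H \<Longrightarrow> coord (c \<odot>\<^bsub>H\<^esub> x) i = c * coord x i"
  by (simp add: coord_def cinner_smult_left u_in)

lemma comb_in: "comb a \<in> carrier H"
  unfolding comb_def using u_in by (intro M.finsum_closed) auto

lemma cinner_comb: "z \<in> carrier H \<Longrightarrow> cinner H (comb a) z = (\<Sum>i<m. a i * cinner H (u i) z)"
  unfolding comb_def by (subst cinner_finsum_left) (auto simp: u_in cinner_smult_left)

lemma comb_coord: "x \<in> carrier H \<Longrightarrow> comb (coord x) = x"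
  by (rule cinner_ext[OF comb_in]) (simp_all add: cinner_comb coord_def u_expand[of x])

lemma comb_add: "comb (\<lambda>i. a i + b i) = comb a \<oplus>\<^bsub>H\<^esub> comb b"
  by (rule cinner_ext)
     (auto simp: comb_in cinner_comb cinner_add_left distrib_right sum.distrib)

lemma comb_smult: "comb (\<lambda>i. c * a i) = c \<odot>\<^bsub>H\<^esub> comb a"
  by (rule cinner_ext)
     (auto simp: comb_in cinner_comb cinner_smult_left sum_distrib_left mult.assoc)

lemma cinner_comb_comb: "cinner H (comb a) (comb b) = (\<Sum>i<m. a i * cnj (b i))"
proof -
  have "cinner H (u i) (comb b) = cnj (b i)" if "i < m" for i
  proof -
    have "cinner H (comb b) (u i) = (\<Sum>j<m. if j = i then b j else 0)"
      unfolding cinner_comb[OF u_in[OF that]] using that by (intro sum.cong refl) (simp add: u_ip)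
    then show ?thesis using that cinner_commute[OF u_in[OF that] comb_in] by simp
  qed
  then show ?thesis by (simp add: cinner_comb comb_in)
qed

end

lemma finite_dimensional_onb_space:
  assumes "complex_hilbert_space H" "finite_dimensional H"
  obtains m u where "onb_space H m u"
proof -
  interpret complex_hilbert_space H by fact
  show ?thesis
  proof (rule finite_dimensional_orthonormal_basis[OF assms(2)])
    fix m :: nat and u
    assume "\<And>i. i < m \<Longrightarrow> u i \<in> carrier H"
      and "\<And>i j. i < m \<Longrightarrow> j < m \<Longrightarrow> cinner H (u i) (u j) = (if i = j then 1 else 0)"
      and "\<And>x z. x \<in> carrier H \<Longrightarrow> z \<in> carrier H \<Longrightarrow>
        cinner H x z = (\<Sum>i<m. cinner H x (u i) * cinner H (u i) z)"
    then have "onb_space H m u"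
      by (intro onb_space.intro onb_space_axioms.intro assms(1)) assumption+
    then show ?thesis by (rule that)
  qed
qed

section \<open>Tensor product of a finite dimensional space with the sequence space\<close>

locale sequence_tensor = sequence_embedding emb + onb_space H m u
  for emb :: "(nat \<Rightarrow> complex) \<Rightarrow> 'k" and H :: "'a inner_module" (structure) and m u
begin

text \<open>The tensor product is realized as \<open>m\<close> copies of the sequence space placed
  in disjoint blocks of \<open>nat\<close> by the pairing function; \<open>u i \<otimes> y\<close>
  is \<open>y\<close> written into block \<open>i\<close>.\<close>

abbreviation block :: "nat \<Rightarrow> nat \<Rightarrow> nat" where
  "block i j \<equiv> prod_encode (i, j)"

text \<open>Blocks from index \<open>m\<close> on belong to no basis vector; leaving them in would
  violate density of the elementary tensors.\<close>

definition tensor_supp :: "nat set" where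
  "tensor_supp = {k. fst (prod_decode k) < m}"

definition tens :: "'a \<Rightarrow> 'k \<Rightarrow> 'k" where
  "tens x y = emb (\<lambda>k. \<Sum>i<m. coord x i * push (block i) (dec y) k)"

lemma inj_block: "inj (block i)"
  by (auto intro: injI)

lemma push_block: "push (block i) a (block l j) = (if l = i then a j else 0)"
  using push_apply[OF inj_block, of i a j] by (auto simp: push_def)

lemma ell2_tens: "ell2 a \<Longrightarrow> ell2 (\<lambda>k. \<Sum>i<m. c i * push (block i) a k)"
  by (intro ell2_sum ell2_scale ell2_push inj_block) auto

lemma dec_tens_supp: "k \<notin> tensor_supp \<Longrightarrow> dec (tens x y) k = 0"
proof -
  assume k: "k \<notin> tensor_supp"
  obtain l j where lj: "k = block l j" by (metis prod_decode_inverse surj_pair)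
  with k show ?thesis by (auto simp: tens_def tensor_supp_def push_block)
qed

lemma tens_in: "y \<in> carrier (E UNIV) \<Longrightarrow> tens x y \<in> carrier (E tensor_supp)"
  using dec_tens_supp[of _ x y] ell2_tens[OF in_E(2)] by (simp add: tens_def emb_in_iff)

text \<open>Distinct blocks are disjoint, so only the diagonal terms of the double sum
  survive.\<close>

lemma ip_tens:
  assumes "x \<in> carrier H" "x' \<in> carrier H" and y: "ell2 (dec y)" "ell2 (dec y')"
  shows "ip (dec (tens x y)) (dec (tens x' y')) = cinner H x x' * ip (dec y) (dec y')"
proof -
  have e: "ell2 (\<lambda>k. c * push (block i) a k)" if "ell2 a" for a c i
    by (intro ell2_scale ell2_push inj_block that)
  have one: "ip (push (block i) (dec y)) (\<lambda>k. \<Sum>l<m. coord x' l * push (block l) (dec y') k)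
      = cnj (coord x' i) * ip (dec y) (dec y')" if "i < m" for i
  proof -
    have "(\<Sum>l<m. coord x' l * push (block l) (dec y') (block i j)) = coord x' i * dec y' j" for j
    proof -
      have "(\<Sum>l<m. coord x' l * push (block l) (dec y') (block i j)) = (\<Sum>l<m. if i = l then coord x' l * dec y' j else 0)"
        by (intro sum.cong refl) (simp add: push_block)
      then show ?thesis using that by simp
    qed
    then show ?thesis by (simp add: ip_push_left[OF inj_block] ip_scale_right)
  qed
  have "ip (dec (tens x y)) (dec (tens x' y')) =
      (\<Sum>i<m. ip (\<lambda>k. coord x i * push (block i) (dec y) k) (\<lambda>k. \<Sum>l<m. coord x' l * push (block l) (dec y') k))"
    unfolding tens_def dec_emb by (rule ip_sum_left) (auto intro: e y ell2_tens)
  also have "\<dots> = (\<Sum>i<m. coord x i * cnj (coord x' i)) * ip (dec y) (dec y')"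
    by (simp add: ip_scale_left one sum_distrib_right mult.assoc)
  also have "(\<Sum>i<m. coord x i * cnj (coord x' i)) = ip (coord x) (coord x')"
    by (rule ell2_finite_support(2)[symmetric]) (auto simp: coord_def)
  finally show ?thesis by (simp add: ip_coord assms)
qed

text \<open>Cutting \<open>t\<close> into its blocks writes it as a sum of \<open>m\<close>
  elementary tensors, so the density condition holds with error zero.\<close>

lemma tens_decomp:
  assumes t: "t \<in> carrier (E tensor_supp)"
  shows "\<And>i. emb (\<lambda>j. dec t (block i j)) \<in> carrier (E UNIV)"
    and "t = (\<Oplus>\<^bsub>E tensor_supp\<^esub>i\<in>{..<m}. tens (u i) (emb (\<lambda>j. dec t (block i j))))"
proof -
  interpret ET: module complex_scalars "E tensor_supp" by (rule module_E)
  show b: "emb (\<lambda>j. dec t (block i j)) \<in> carrier (E UNIV)" for i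
    using ell2_comp_inj[OF in_E(2)[OF t] inj_block] by (simp add: emb_in_iff)
  have "(\<Sum>i<m. \<Sum>l<m. coord (u i) l * push (block l) (\<lambda>j. dec t (block i j)) k) = dec t k" for k
  proof -
    obtain l j where lj: "k = block l j" by (metis prod_decode_inverse surj_pair)
    have "(\<Sum>i<m. \<Sum>l<m. coord (u i) l * push (block l) (\<lambda>j. dec t (block i j)) k)
        = (\<Sum>i<m. push (block i) (\<lambda>j. dec t (block i j)) k)"
    proof (intro sum.cong refl)
      fix i assume "i \<in> {..<m}"
      then have "(\<Sum>l<m. coord (u i) l * push (block l) (\<lambda>j. dec t (block i j)) k) =
         (\<Sum>l<m. if i = l then push (block l) (\<lambda>j. dec t (block i j)) k else 0)"
        by (intro sum.cong refl) (simp add: coord_def u_ip)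
      then show "(\<Sum>l<m. coord (u i) l * push (block l) (\<lambda>j. dec t (block i j)) k) = push (block i) (\<lambda>j. dec t (block i j)) k"
        using \<open>i \<in> {..<m}\<close> by simp
    qed
    also have "\<dots> = (\<Sum>i<m. if l = i then dec t (block i j) else 0)"
      by (intro sum.cong refl) (simp add: lj push_block)
    also have "\<dots> = dec t k"
      using in_E(3)[OF t, of k] by (auto simp: lj tensor_supp_def)
    finally show ?thesis .
  qed
  then show "t = (\<Oplus>\<^bsub>E tensor_supp\<^esub>i\<in>{..<m}. tens (u i) (emb (\<lambda>j. dec t (block i j))))"
    using t b by (intro E_eqI[of _ tensor_supp] ET.M.finsum_closed) (auto simp: dec_finsum tens_in, simp add: tens_def)
qed

lemma hilbert_tensor: "is_hilbert_tensor H (E UNIV) (E tensor_supp) tens"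
  unfolding is_hilbert_tensor_def
proof (intro conjI ballI allI impI)
  interpret ET: complex_hilbert_space "E tensor_supp" by (rule hilbert_E)
  show "complex_hilbert_space (E tensor_supp)" by (rule hilbert_E)
  show "tens x y \<in> carrier (E tensor_supp)" if "y \<in> carrier (E UNIV)" for x y
    by (rule tens_in[OF that])
  show "tens (x \<oplus> x') y = tens x y \<oplus>\<^bsub>E tensor_supp\<^esub> tens x' y"
    if "x \<in> carrier H" "x' \<in> carrier H" for x x' y
    using that by (simp add: tens_def E_sel coord_add distrib_right sum.distrib)
  show "tens x (y \<oplus>\<^bsub>E UNIV\<^esub> y') = tens x y \<oplus>\<^bsub>E tensor_supp\<^esub> tens x y'" for x y y'
    by (simp add: tens_def E_sel push_add distrib_left sum.distrib)
  show "tens (c \<odot> x) y = c \<odot>\<^bsub>E tensor_supp\<^esub> tens x y" if "x \<in> carrier H" for c x y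
    using that by (simp add: tens_def E_sel coord_smult sum_distrib_left mult.assoc)
  show "tens x (c \<odot>\<^bsub>E UNIV\<^esub> y) = c \<odot>\<^bsub>E tensor_supp\<^esub> tens x y" for c x y
    by (simp add: tens_def E_sel push_scale sum_distrib_left mult_ac)
  show "cinner (E tensor_supp) (tens x y) (tens x' y') = cinner H x x' * cinner (E UNIV) y y'"
    if "x \<in> carrier H" "x' \<in> carrier H" "y \<in> carrier (E UNIV)" "y' \<in> carrier (E UNIV)" for x x' y y'
    using that by (simp add: E_sel(4) ip_tens in_E(2))
  fix t and \<epsilon> :: real assume t: "t \<in> carrier (E tensor_supp)" and "0 < \<epsilon>"
  have "t \<ominus>\<^bsub>E tensor_supp\<^esub> (\<Oplus>\<^bsub>E tensor_supp\<^esub>i\<in>{..<m}. tens (u i) (emb (\<lambda>j. dec t (block i j)))) = \<zero>\<^bsub>E tensor_supp\<^esub>"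
    unfolding tens_decomp(2)[OF t, symmetric] using t by (simp add: ET.diff_eq_zero_iff)
  then show "\<exists>(n::nat) a b. (\<forall>i<n. a i \<in> carrier H \<and> b i \<in> carrier (E UNIV)) \<and>
      hnorm (E tensor_supp) (t \<ominus>\<^bsub>E tensor_supp\<^esub> (\<Oplus>\<^bsub>E tensor_supp\<^esub>i\<in>{..<n}. tens (a i) (b i))) < \<epsilon>"
    using \<open>0 < \<epsilon>\<close> tens_decomp(1)[OF t] u_in ET.hnorm_zero
    by (intro exI[of _ m] exI[of _ u] exI[of _ "\<lambda>i. emb (\<lambda>j. dec t (block i j))"]) auto
qed

end

section \<open>Realization of positive kernels\<close>

text \<open>Density is phrased through continuous functions because that is how it is consumed, with
  \<open>f\<close> a squared kernel distance. As \<open>U\<close> is open, each sublevel set of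
  \<open>f\<close> in \<open>U\<close> is open and meets the countable dense set.\<close>

lemma dense_sequence:
  fixes U :: "'a::second_countable_topology set"
  assumes "open U" "U \<noteq> {}"
  obtains s :: "nat \<Rightarrow> 'a" where "\<And>n. s n \<in> U"
    and "\<And>(f :: 'a \<Rightarrow> real) t \<epsilon>. continuous_on U f \<Longrightarrow> t \<in> U \<Longrightarrow> f t < \<epsilon> \<Longrightarrow> \<exists>n. f (s n) < \<epsilon>"
proof -
  obtain D :: "'a set" where D: "countable D"
    and dense: "\<And>V. open V \<Longrightarrow> V \<noteq> {} \<Longrightarrow> \<exists>x\<in>D. x \<in> V"
    by (rule countable_dense_setE) blast
  have ne: "D \<inter> U \<noteq> {}" using dense[OF assms] by blast
  define s where "s = from_nat_into (D \<inter> U)"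
  have ran: "range s = D \<inter> U" unfolding s_def using D ne by (simp add: range_from_nat_into)
  show ?thesis
  proof (rule that[of s])
    show "s n \<in> U" for n using ran by blast
    fix f :: "'a \<Rightarrow> real" and t \<epsilon> assume f: "continuous_on U f" and t: "t \<in> U" "f t < \<epsilon>"
    have "open (U \<inter> f -` {..<\<epsilon>})" by (rule continuous_open_preimage[OF f assms(1)]) simp
    moreover have "t \<in> U \<inter> f -` {..<\<epsilon>}" using t by simp
    ultimately obtain d where "d \<in> D" "d \<in> U" "f d < \<epsilon>" using dense by fastforce
    then show "\<exists>n. f (s n) < \<epsilon>" using ran by (metis IntI imageE)
  qed
qed

text \<open>The function \<open>kernel_dist2 G t\<close> vanishes at \<open>t\<close>, so continuity
  makes it small at some pivot of a dense sequence, and Parseval applies at every point of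
  \<open>U\<close>.\<close>

lemma continuous_kernel_factorization:
  fixes U :: "'a::second_countable_topology set"
  assumes U: "open U" and G: "psd_on U G"
    and cont: "\<And>t. t \<in> U \<Longrightarrow> continuous_on U (kernel_dist2 G t)"
  obtains k :: "'a \<Rightarrow> nat \<Rightarrow> complex" where "\<And>t. t \<in> U \<Longrightarrow> ell2 (k t)"
    and "\<And>t u. t \<in> U \<Longrightarrow> u \<in> U \<Longrightarrow> ip (k t) (k u) = G t u"
proof (cases "U = {}")
  case False
  obtain s :: "nat \<Rightarrow> 'a" where s: "\<And>n. s n \<in> U"
    and dense: "\<And>(f :: 'a \<Rightarrow> real) t \<epsilon>. continuous_on U f \<Longrightarrow> t \<in> U \<Longrightarrow> f t < \<epsilon> \<Longrightarrow> \<exists>n. f (s n) < \<epsilon>"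
    by (rule dense_sequence[OF U False]) blast
  interpret pivoted_kernel U G s by unfold_locales (rule G s)+
  show ?thesis
  proof (rule that[of "schur_coord G s"])
    show "ell2 (schur_coord G s t)" if "t \<in> U" for t by (rule ell2_schur_coord(1)[OF that])
    show "ip (schur_coord G s t) (schur_coord G s u) = G t u" if "t \<in> U" "u \<in> U" for t u
      by (rule ip_schur_coord[OF that]) (rule dense[OF cont], use that in auto)
  qed
qed auto

section \<open>Continuity of polynomial maps\<close>

lemma continuous_on_monomial_at: "continuous_on S (monomial_at \<alpha>)"
  unfolding monomial_at_def by (intro continuous_intros)

lemma continuous_on_polynomial_fun: "polynomial_fun f \<Longrightarrow> continuous_on S f"
proof -
  assume "polynomial_fun f"
  then obtain F c where "finite F" "f = (\<lambda>\<tau>. \<Sum>\<alpha>\<in>F. monomial_at \<alpha> \<tau> * c \<alpha>)"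
    by (auto simp: polynomial_fun_def)
  then show ?thesis by (auto intro!: continuous_intros continuous_on_monomial_at)
qed

context onb_space begin

lemma polynomial_map_in: "polynomial_map H p \<Longrightarrow> p \<tau> \<in> carrier H"
  unfolding polynomial_map_def by (auto intro!: M.finsum_closed)

lemma continuous_on_coord_polynomial_map:
  assumes "polynomial_map H p"
  shows "continuous_on S (\<lambda>\<tau>. coord (p \<tau>) i)"
proof -
  obtain F c where F: "finite F" "\<And>\<alpha>. \<alpha> \<in> F \<Longrightarrow> c \<alpha> \<in> carrier H"
    and p: "\<And>\<tau>. p \<tau> = (\<Oplus>\<^bsub>H\<^esub>\<alpha>\<in>F. monomial_at \<alpha> \<tau> \<odot>\<^bsub>H\<^esub> c \<alpha>)"
    using assms by (auto simp: polynomial_map_def)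
  have "cinner H (p \<tau>) (u i) = (\<Sum>\<alpha>\<in>F. monomial_at \<alpha> \<tau> * cinner H (c \<alpha>) (u i))" if "i < m" for \<tau>
    unfolding p by (subst cinner_finsum_left) (use F u_in[OF that] in \<open>auto simp: cinner_smult_left\<close>)
  then show ?thesis
    by (cases "i < m") (auto simp: coord_def intro!: continuous_intros continuous_on_monomial_at)
qed

lemma continuous_on_cinner_polynomial_map:
  assumes p: "polynomial_map H p" and f: "continuous_on S f" and g: "continuous_on S g"
  shows "continuous_on S (\<lambda>t. cinner H (p (f t)) (p (g t)))"
proof -
  have "cinner H (p \<tau>) (p \<sigma>) = (\<Sum>i\<in>{..<m}. coord (p \<tau>) i * cnj (coord (p \<sigma>) i))" for \<tau> \<sigma>
    unfolding ip_coord[OF polynomial_map_in[OF p] polynomial_map_in[OF p], symmetric]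
    by (rule ell2_finite_support) (auto simp: coord_def)
  moreover have "continuous_on S (\<lambda>t. coord (p (h t)) i)" if "continuous_on S h" for h i
    using continuous_on_compose2[OF continuous_on_coord_polynomial_map[OF p, of UNIV i] that] by simp
  ultimately show ?thesis by (simp add: continuous_intros f g)
qed

end

section \<open>Block operators cut out of an isometry of sequences\<close>

lemma hilbert_sum_sel:
  "carrier (hilbert_sum H G) = carrier H \<times> carrier G"
  "(x, y) \<oplus>\<^bsub>hilbert_sum H G\<^esub> (x', y') = (x \<oplus>\<^bsub>H\<^esub> x', y \<oplus>\<^bsub>G\<^esub> y')"
  "c \<odot>\<^bsub>hilbert_sum H G\<^esub> (x, y) = (c \<odot>\<^bsub>H\<^esub> x, c \<odot>\<^bsub>G\<^esub> y)"
  "cinner (hilbert_sum H G) (x, y) (x', y') = cinner H x x' + cinner G y y'"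
  by (simp_all add: hilbert_sum_def)

lemma ell2_case_sum: "ell2 a \<Longrightarrow> ell2 b \<Longrightarrow> ell2 (case_sum a b)"
  by (rule ell2_Sum) simp_all

lemma ip_case_sum:
  "ell2 a \<Longrightarrow> ell2 b \<Longrightarrow> ell2 a' \<Longrightarrow> ell2 b' \<Longrightarrow>
    ip (case_sum a b) (case_sum a' b') = ip a a' + ip b b'"
  by (subst ip_Sum) (simp_all add: ell2_case_sum o_def)

text \<open>\<open>W\<close> acts on all of \<open>ell2\<close> over \<open>nat + nat\<close>: the
  left summand carries the tensor product on input and the state space on output, the right one the
  coordinates of \<open>K1\<close> and \<open>K2\<close>. \<open>W_supp\<close> ensures that the
  right part of the output is the coordinate sequence of a vector of \<open>K2\<close>.\<close>

locale isometric_model =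
  sequence_embedding emb + K1: onb_space K1 m1 u1 + K2: onb_space K2 m2 u2 + K3: sequence_tensor emb K3 m3 u3
  for emb :: "(nat \<Rightarrow> complex) \<Rightarrow> 'k"
    and K1 :: "'a inner_module" and m1 u1
    and K2 :: "'b inner_module" and m2 u2
    and K3 :: "'c inner_module" and m3 u3 +
  fixes W :: "(nat + nat \<Rightarrow> complex) \<Rightarrow> nat + nat \<Rightarrow> complex"
  assumes W_ell2: "ell2 a \<Longrightarrow> ell2 (W a)"
    and W_ip: "ell2 a \<Longrightarrow> ell2 b \<Longrightarrow> ip (W a) (W b) = ip a b"
    and W_supp: "m2 \<le> i \<Longrightarrow> W a (Inr i) = 0"
begin

definition left :: "'k \<Rightarrow> nat + nat \<Rightarrow> complex" where
  "left t = case_sum (dec t) (\<lambda>_. 0)"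

definition right :: "'a \<Rightarrow> nat + nat \<Rightarrow> complex" where
  "right v = case_sum (\<lambda>_. 0) (K1.coord v)"

definition outK :: "(nat + nat \<Rightarrow> complex) \<Rightarrow> 'k" where
  "outK w = emb (\<lambda>n. w (Inl n))"

definition out2 :: "(nat + nat \<Rightarrow> complex) \<Rightarrow> 'b \<times> 'k" where
  "out2 w = (K2.comb (\<lambda>i. w (Inr i)), emb (\<lambda>_. 0))"

abbreviation "opA \<equiv> \<lambda>t. outK (W (left t))"
abbreviation "opB \<equiv> \<lambda>v. outK (W (right v))"
abbreviation "opC \<equiv> \<lambda>t. out2 (W (left t))"
abbreviation "opD \<equiv> \<lambda>v. out2 (W (right v))"
abbreviation "K \<equiv> E UNIV"
abbreviation "T \<equiv> E K3.tensor_supp"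

lemma W_linear: "ell2 a \<Longrightarrow> ell2 b \<Longrightarrow> W (\<lambda>i. c * a i + b i) m = c * W a m + W b m"
  by (rule gram_preserving_linear[of W]) (simp_all add: W_ell2 W_ip)

lemma W_add: "ell2 a \<Longrightarrow> ell2 b \<Longrightarrow> W (\<lambda>i. a i + b i) m = W a m + W b m"
  using W_linear[of a b 1 m] by simp

lemma W_scale: "ell2 a \<Longrightarrow> W (\<lambda>i. c * a i) m = c * W a m"
proof -
  have "W (\<lambda>_. 0) m = 0"
    by (rule ip_definite) (simp_all add: W_ell2 W_ip, simp add: ip_def)
  then show "ell2 a \<Longrightarrow> W (\<lambda>i. c * a i) m = c * W a m" using W_linear[of a "\<lambda>_. 0" c m] by simp
qed

lemma outK_in: "ell2 w \<Longrightarrow> outK w \<in> carrier K"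
  using ell2_comp_inj[of w Inl] by (simp add: outK_def emb_in_iff)

lemma out2_in: "out2 w \<in> carrier (hilbert_sum K2 (E {}))"
  by (simp add: out2_def hilbert_sum_sel K2.comb_in emb_in_iff)

lemma outK_add: "outK (\<lambda>i. w i + w' i) = outK w \<oplus>\<^bsub>K\<^esub> outK w'"
  by (simp add: outK_def E_sel)

lemma out2_add: "out2 (\<lambda>i. w i + w' i) = out2 w \<oplus>\<^bsub>hilbert_sum K2 (E {})\<^esub> out2 w'"
  by (simp add: out2_def E_sel hilbert_sum_sel K2.comb_add)

text \<open>The four blocks and the joint map on pairs are all of this shape, with \<open>f\<close>
  encoding the input as a sequence.\<close>

lemma linear_through_W:
  assumes e: "\<And>x. x \<in> carrier H \<Longrightarrow> ell2 (f x)"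
    and add: "\<And>x y. x \<in> carrier H \<Longrightarrow> y \<in> carrier H \<Longrightarrow> f (x \<oplus>\<^bsub>H\<^esub> y) = (\<lambda>i. f x i + f y i)"
    and smult: "\<And>c x. x \<in> carrier H \<Longrightarrow> f (c \<odot>\<^bsub>H\<^esub> x) = (\<lambda>i. c * f x i)"
  shows "linear_operator H K (\<lambda>x. outK (W (f x)))"
    and "linear_operator H (hilbert_sum K2 (E {})) (\<lambda>x. out2 (W (f x)))"
proof -
  have a: "W (f (x \<oplus>\<^bsub>H\<^esub> y)) = (\<lambda>i. W (f x) i + W (f y) i)" if "x \<in> carrier H" "y \<in> carrier H" for x y
    using that by (intro ext) (simp add: add W_add e)
  have s: "W (f (c \<odot>\<^bsub>H\<^esub> x)) = (\<lambda>i. c * W (f x) i)" if "x \<in> carrier H" for c x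
    using that by (intro ext) (simp add: smult W_scale e)
  show "linear_operator H K (\<lambda>x. outK (W (f x)))"
    unfolding linear_operator_def
    by (auto simp: a s outK_add outK_in W_ell2 e) (simp add: outK_def E_sel)
  show "linear_operator H (hilbert_sum K2 (E {})) (\<lambda>x. out2 (W (f x)))"
    unfolding linear_operator_def
    by (auto simp: a s out2_add out2_in) (simp add: out2_def E_sel hilbert_sum_sel K2.comb_smult)
qed

lemma left_props:
  "t \<in> carrier T \<Longrightarrow> ell2 (left t)"
  "left (t \<oplus>\<^bsub>T\<^esub> t') = (\<lambda>i. left t i + left t' i)"
  "left (c \<odot>\<^bsub>T\<^esub> t) = (\<lambda>i. c * left t i)"
  by (auto simp: left_def E_sel in_E(2) fun_eq_iff intro!: ell2_case_sum split: sum.split)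

lemma right_props:
  "ell2 (right v)"
  "v \<in> carrier K1 \<Longrightarrow> v' \<in> carrier K1 \<Longrightarrow> right (v \<oplus>\<^bsub>K1\<^esub> v') = (\<lambda>i. right v i + right v' i)"
  "v \<in> carrier K1 \<Longrightarrow> right (c \<odot>\<^bsub>K1\<^esub> v) = (\<lambda>i. c * right v i)"
  by (auto simp: right_def K1.ell2_coord K1.coord_add K1.coord_smult fun_eq_iff intro!: ell2_case_sum split: sum.split)

lemma left_right: "(\<lambda>i. left t i + right v i) = case_sum (dec t) (K1.coord v)"
  by (auto simp: left_def right_def split: sum.split)

text \<open>By additivity the sum of the block images is a single application of \<open>W\<close> to
  the joint sequence, where norms can be compared.\<close>

lemma block_out:
  assumes "t \<in> carrier T"
  shows "opA t \<oplus>\<^bsub>K\<^esub> opB v = outK (W (case_sum (dec t) (K1.coord v)))"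
    and "opC t \<oplus>\<^bsub>hilbert_sum K2 (E {})\<^esub> opD v = out2 (W (case_sum (dec t) (K1.coord v)))"
proof -
  have "W (case_sum (dec t) (K1.coord v)) = (\<lambda>i. W (left t) i + W (right v) i)"
    unfolding left_right[symmetric] using assms by (intro ext W_add left_props right_props)
  then show "opA t \<oplus>\<^bsub>K\<^esub> opB v = outK (W (case_sum (dec t) (K1.coord v)))"
    and "opC t \<oplus>\<^bsub>hilbert_sum K2 (E {})\<^esub> opD v = out2 (W (case_sum (dec t) (K1.coord v)))"
    by (simp_all add: outK_add out2_add)
qed

text \<open>Decoding loses no norm: by \<open>W_supp\<close> the entries seen by
  \<open>K2.comb\<close> are the whole right part of the output.\<close>

lemma cinner_out:
  assumes "ell2 a"
  shows "cinner (hilbert_sum K (hilbert_sum K2 (E {}))) (outK (W a), out2 (W a)) (outK (W a), out2 (W a)) = ip a a"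
proof -
  have "(\<Sum>i<m2. W a (Inr i) * cnj (W a (Inr i))) = ip (\<lambda>i. W a (Inr i)) (\<lambda>i. W a (Inr i))"
    by (rule ell2_finite_support(2)[symmetric]) (auto simp: W_supp)
  then show ?thesis
    using ip_Sum[OF W_ell2[OF assms] W_ell2[OF assms]] W_ip[OF assms assms]
    by (simp add: outK_def out2_def hilbert_sum_sel E_sel K2.cinner_comb_comb o_def) (simp add: ip_def)
qed

lemma isometric_blocks:
  "isometric_block_matrix T K1 K (hilbert_sum K2 (E {})) opA opB opC opD"
  unfolding isometric_block_matrix_def
proof (intro conjI)
  show "linear_operator T K opA" "linear_operator T (hilbert_sum K2 (E {})) opC"
    by (rule linear_through_W; simp add: left_props)+
  show "linear_operator K1 K opB" "linear_operator K1 (hilbert_sum K2 (E {})) opD"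
    by (rule linear_through_W; simp add: right_props)+
  let ?f = "\<lambda>(t, v). case_sum (dec t) (K1.coord v)"
  let ?H = "hilbert_sum T K1"
  have f: "linear_operator ?H K (\<lambda>p. outK (W (?f p)))"
    "linear_operator ?H (hilbert_sum K2 (E {})) (\<lambda>p. out2 (W (?f p)))"
    by (rule linear_through_W;
        auto simp: hilbert_sum_sel E_sel in_E(2) K1.ell2_coord K1.coord_add K1.coord_smult fun_eq_iff
          intro!: ell2_case_sum split: sum.split)+
  define S where "S = (\<lambda>(t, v). (opA t \<oplus>\<^bsub>K\<^esub> opB v, opC t \<oplus>\<^bsub>hilbert_sum K2 (E {})\<^esub> opD v))"
  have eq: "S p = (outK (W (?f p)), out2 (W (?f p)))" if "p \<in> carrier ?H" for p
    using that by (auto simp: S_def hilbert_sum_sel(1) block_out)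
  have closed: "x \<oplus>\<^bsub>?H\<^esub> y \<in> carrier ?H" "c \<odot>\<^bsub>?H\<^esub> x \<in> carrier ?H" if "x \<in> carrier ?H" "y \<in> carrier ?H" for x y c
  proof -
    interpret T: complex_hilbert_space T by (rule hilbert_E)
    show "x \<oplus>\<^bsub>?H\<^esub> y \<in> carrier ?H" "c \<odot>\<^bsub>?H\<^esub> x \<in> carrier ?H"
      using that by (auto simp: hilbert_sum_sel)
  qed
  show "linear_isometry ?H (hilbert_sum K (hilbert_sum K2 (E {})))
     (\<lambda>(t, v). (opA t \<oplus>\<^bsub>K\<^esub> opB v, opC t \<oplus>\<^bsub>hilbert_sum K2 (E {})\<^esub> opD v))" (is "linear_isometry _ ?G _")
    unfolding linear_isometry_def S_def[symmetric]
  proof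
    show "linear_operator ?H ?G S"
      unfolding linear_operator_def
    proof (intro conjI ballI allI)
      show "S \<in> carrier ?H \<rightarrow> carrier ?G"
      proof (rule funcsetI)
        fix p assume p: "p \<in> carrier ?H"
        have "outK (W (?f p)) \<in> carrier K" "out2 (W (?f p)) \<in> carrier (hilbert_sum K2 (E {}))"
          using f p unfolding linear_operator_def by blast+
        then show "S p \<in> carrier ?G" by (simp add: eq[OF p] hilbert_sum_sel(1)[of K])
      qed
      show "S (x \<oplus>\<^bsub>?H\<^esub> y) = S x \<oplus>\<^bsub>?G\<^esub> S y" if "x \<in> carrier ?H" "y \<in> carrier ?H" for x y
        using f that unfolding linear_operator_def by (simp only: eq closed hilbert_sum_sel(2)[of K])
      show "S (c \<odot>\<^bsub>?H\<^esub> x) = c \<odot>\<^bsub>?G\<^esub> S x" if "x \<in> carrier ?H" for c x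
        using f that unfolding linear_operator_def by (simp only: eq closed hilbert_sum_sel(3)[of K])
    qed
    show "\<forall>p\<in>carrier ?H. hnorm ?G (S p) = hnorm ?H p"
    proof
      fix p assume p: "p \<in> carrier ?H"
      then obtain t v where tv: "p = (t, v)" "t \<in> carrier T" "v \<in> carrier K1" by (auto simp: hilbert_sum_sel)
      have e: "ell2 (dec t)" using tv in_E(2) by blast
      have "cinner ?G (S p) (S p) = ip (?f p) (?f p)"
        unfolding eq[OF p] by (rule cinner_out) (simp add: tv ell2_case_sum e K1.ell2_coord)
      also have "\<dots> = cinner ?H p p"
        using tv e by (simp add: ip_case_sum K1.ell2_coord hilbert_sum_sel E_sel K1.ip_coord)
      finally show "hnorm ?G (S p) = hnorm ?H p" by (simp add: hnorm_def)
    qed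
  qed
qed

text \<open>\<open>opA\<close> is a compression of the isometry: the right part of
  \<open>W (left t)\<close> is dropped, and its contribution to the norm is nonnegative.\<close>

lemma hnorm_opA_le: "t \<in> carrier T \<Longrightarrow> hnorm K (opA t) \<le> hnorm T t"
proof -
  assume t: "t \<in> carrier T"
  have "ip (W (left t)) (W (left t)) = ip (dec t) (dec t)"
    using t in_E(2)[OF t] by (simp add: W_ip left_props) (simp add: left_def ip_case_sum, simp add: ip_def)
  moreover have "0 \<le> Re (ip (\<lambda>i. W (left t) (Inr i)) (\<lambda>i. W (left t) (Inr i)))"
    by (intro ip_self_nonneg ell2_comp_inj[OF W_ell2]) (simp_all add: left_props t)
  ultimately have "Re (ip (\<lambda>n. W (left t) (Inl n)) (\<lambda>n. W (left t) (Inl n))) \<le> Re (ip (dec t) (dec t))"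
    using arg_cong[OF ip_Sum[OF W_ell2 W_ell2, OF left_props(1)[OF t] left_props(1)[OF t]], of Re] by (simp add: o_def)
  then show ?thesis by (simp add: hnorm_E outK_def)
qed

lemma pencil_invertible:
  assumes w: "w \<in> carrier K3" and c: "hnorm K3 w < cmod c"
  shows "invertible_on K (pencil K K3.tens opA c w)"
proof -
  interpret HK: complex_hilbert_space K by (rule hilbert_E)
  interpret HT: complex_hilbert_space T by (rule hilbert_E)
  have A: "linear_operator T K opA"
    using isometric_blocks by (simp add: isometric_block_matrix_def)
  define N where "N = (\<lambda>x. opA (K3.tens w x))"
  have N: "N x \<in> carrier K" if "x \<in> carrier K" for x
    using A K3.tens_in[OF that] by (auto simp: N_def linear_operator_def)
  have tens_diff: "K3.tens w (x \<ominus>\<^bsub>K\<^esub> y) = K3.tens w x \<oplus>\<^bsub>T\<^esub> (-1) \<odot>\<^bsub>T\<^esub> K3.tens w y"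
    if "x \<in> carrier K" "y \<in> carrier K" for x y
  proof -
    have "dec (K3.tens w (x \<ominus>\<^bsub>K\<^esub> y)) k = dec (K3.tens w x) k - dec (K3.tens w y) k" for k
      using that by (simp add: K3.tens_def E_diff push_diff right_diff_distrib sum_subtractf)
    then show ?thesis
      using that by (intro E_eqI[of _ K3.tensor_supp]) (auto simp: K3.tens_in, simp add: E_sel)
  qed
  have N_diff: "N (x \<ominus>\<^bsub>K\<^esub> y) = N x \<ominus>\<^bsub>K\<^esub> N y" if "x \<in> carrier K" "y \<in> carrier K" for x y
    using A that HK.diff_eq_smult[OF N N, OF that]
    by (simp add: N_def tens_diff linear_operator_def K3.tens_in)
  have N_le: "hnorm K (N x) \<le> hnorm K3 w * hnorm K x" if "x \<in> carrier K" for x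
  proof -
    have "hnorm K (N x) \<le> hnorm T (K3.tens w x)"
      unfolding N_def by (intro hnorm_opA_le K3.tens_in that)
    also have "\<dots> = hnorm K3 w * hnorm K x"
      using that w by (simp add: hnorm_E K3.ip_tens in_E(2) K3.cinner_self ip_self real_sqrt_mult K3.hnorm_nonneg)
    finally show ?thesis .
  qed
  have "bij_betw (\<lambda>x. c \<odot>\<^bsub>K\<^esub> x \<ominus>\<^bsub>K\<^esub> N x) (carrier K) (carrier K)"
  proof (rule HK.bij_betw_scalar_minus_contraction[OF N _ c])
    show "hnorm K (N x \<ominus>\<^bsub>K\<^esub> N y) \<le> hnorm K3 w * hnorm K (x \<ominus>\<^bsub>K\<^esub> y)" if "x \<in> carrier K" "y \<in> carrier K" for x y
      using N_le[of "x \<ominus>\<^bsub>K\<^esub> y"] that by (simp add: N_diff)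
  qed (use K3.hnorm_nonneg[OF w] in auto)
  then show ?thesis by (simp add: invertible_on_def pencil_def N_def)
qed

end

section \<open>Positivity of realized kernels\<close>

lemma psd_on_form_nonneg:
  fixes n :: nat
  assumes G: "psd_on I G" and t: "\<And>k. k < n \<Longrightarrow> t k \<in> I"
  shows "(\<Sum>k<n. \<Sum>l<n. G (t k) (t l) * c k * cnj (c l)) \<in> \<real>\<^sub>\<ge>\<^sub>0"
proof -
  let ?S = "\<Sum>k<n. \<Sum>l<n. G (t k) (t l) * c k * cnj (c l)"
  have "cnj ?S = (\<Sum>k<n. \<Sum>l<n. G (t l) (t k) * c l * cnj (c k))"
    unfolding cnj_sum
  proof (intro sum.cong refl)
    fix k l assume "k \<in> {..<n}" "l \<in> {..<n}"
    then have "G (t l) (t k) = cnj (G (t k) (t l))" by (intro psd_on_herm[OF G]) (auto intro: t)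
    then show "cnj (G (t k) (t l) * c k * cnj (c l)) = G (t l) (t k) * c l * cnj (c k)"
      by (simp add: mult_ac)
  qed
  also have "\<dots> = ?S" by (rule sum.swap)
  finally have "?S \<in> \<real>" by (simp only: Reals_cnj_iff)
  then have "Im ?S = 0" by (simp only: complex_is_Real_iff)
  moreover have "0 \<le> Re ?S" by (rule psd_on_form[OF G t])
  ultimately show ?thesis by (simp only: complex_nonneg_Reals_iff)
qed

lemma gram_kernel_positive:
  fixes U :: "(complex^'d) set"
  assumes "complex_hilbert_space K" and v: "\<And>\<tau>. \<tau> \<in> U \<Longrightarrow> v \<tau> \<in> carrier K"
    and L: "\<And>\<tau> \<sigma>. \<tau> \<in> U \<Longrightarrow> \<sigma> \<in> U \<Longrightarrow> L \<tau> (vec_cnj \<sigma>) = cinner K (v \<tau>) (v \<sigma>)"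
  shows "positive_semidefinite_kernel U L"
  unfolding positive_semidefinite_kernel_def
proof (intro allI impI)
  interpret complex_hilbert_space K by fact
  fix n :: nat and \<tau> :: "nat \<Rightarrow> complex^'d" and c
  assume \<tau>: "\<forall>k<n. \<tau> k \<in> U"
  have "(\<Sum>k<n. \<Sum>l<n. cinner K (v (\<tau> k)) (v (\<tau> l)) * c k * cnj (c l)) \<in> \<real>\<^sub>\<ge>\<^sub>0"
    by (rule psd_on_form_nonneg[OF psd_on_cinner]) (use \<tau> v in auto)
  then show "(\<Sum>k<n. \<Sum>l<n. L (\<tau> k) (vec_cnj (\<tau> l)) * c k * cnj (c l)) \<in> \<real>\<^sub>\<ge>\<^sub>0"
    using \<tau> by (simp add: L)
qed

text \<open>A realization exhibits \<open>L\<close> as the Gram kernel of the state vectors, which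
  lie in the carrier because the pencil is a bijection of it.\<close>

lemma realized_kernel_positive:
  assumes col: "isometric_colligation K1 K2 K3 K T tens E A B C D"
    and real: "realizes_kernel U L K tens A B q r p1"
    and p1: "\<And>\<tau>. p1 \<tau> \<in> carrier K1"
  shows "positive_semidefinite_kernel U L"
proof (rule gram_kernel_positive)
  show "complex_hilbert_space K" using col by (simp add: isometric_colligation_def)
  have "linear_operator K1 K B"
    using col by (simp add: isometric_colligation_def isometric_block_matrix_def)
  then have B: "B (p1 \<tau>) \<in> carrier K" for \<tau> using p1 by (auto simp: linear_operator_def)
  show "state_map K tens A B q r p1 \<tau> \<in> carrier K" if "\<tau> \<in> U" for \<tau>
  proof -
    have "bij_betw (pencil K tens A (q \<tau>) (r \<tau>)) (carrier K) (carrier K)"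
      using real that by (simp add: realizes_kernel_def invertible_on_def)
    then show ?thesis
      using B unfolding state_map_def by (metis bij_betw_imp_surj_on inv_into_into)
  qed
qed (use real in \<open>simp add: realizes_kernel_def\<close>)

lemma transfer_realization:
  fixes U :: "(complex^'d) set"
    and L :: "complex^'d \<Rightarrow> complex^'d \<Rightarrow> complex"
    and K1 :: "'k1 inner_module" and K2 :: "'k2 inner_module" and K3 :: "'k3 inner_module"
    and p1 :: "complex^'d \<Rightarrow> 'k1" and p2 :: "complex^'d \<Rightarrow> 'k2"
    and q :: "complex^'d \<Rightarrow> complex" and r :: "complex^'d \<Rightarrow> 'k3"
    and emb :: "(nat \<Rightarrow> complex) \<Rightarrow> 'k"
  assumes U: "open U"
    and herm: "hermitian_kernel U L"
    and K1: "complex_hilbert_space K1" "finite_dimensional K1"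
    and K2: "complex_hilbert_space K2" "finite_dimensional K2"
    and K3: "complex_hilbert_space K3" "finite_dimensional K3"
    and p1: "polynomial_map K1 p1" and p2: "polynomial_map K2 p2"
    and q: "polynomial_fun q" and r: "polynomial_map K3 r"
    and less: "\<And>\<tau>. \<tau> \<in> U \<Longrightarrow> cmod (q \<tau>) > hnorm K3 (r \<tau>)"
    and L: "\<And>\<tau> \<sigma>. \<lbrakk>\<tau> \<in> U; \<sigma> \<in> U\<rbrakk> \<Longrightarrow>
      L \<tau> (vec_cnj \<sigma>) =
        (cinner K1 (p1 \<tau>) (p1 \<sigma>) - cinner K2 (p2 \<tau>) (p2 \<sigma>)) /
        (q \<tau> * cnj (q \<sigma>) - cinner K3 (r \<tau>) (r \<sigma>))"
    and emb: "inj emb"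
    and pos: "positive_semidefinite_kernel U L"
  shows "\<exists>(K :: 'k inner_module) (T :: 'k inner_module) tens (E :: 'k inner_module) A B C D.
        isometric_colligation K1 K2 K3 K T tens E A B C D \<and>
        realizes_kernel U L K tens A B q r p1 \<and>
        (\<forall>\<tau>\<in>U. (p2 \<tau>, \<zero>\<^bsub>E\<^esub>) =
          C (tens (r \<tau>) (state_map K tens A B q r p1 \<tau>))
            \<oplus>\<^bsub>hilbert_sum K2 E\<^esub> D (p1 \<tau>))"
proof -
  interpret sequence_embedding emb by unfold_locales (rule emb)
  obtain m1 u1 where o1: "onb_space K1 m1 u1" by (rule finite_dimensional_onb_space[OF K1])
  obtain m2 u2 where o2: "onb_space K2 m2 u2" by (rule finite_dimensional_onb_space[OF K2])
  obtain m3 u3 where o3: "onb_space K3 m3 u3" by (rule finite_dimensional_onb_space[OF K3])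
  interpret K1: onb_space K1 m1 u1 by (rule o1)
  interpret K2: onb_space K2 m2 u2 by (rule o2)
  interpret K3: sequence_tensor emb K3 m3 u3
    by (intro sequence_tensor.intro sequence_embedding_axioms o3)
  note p1_in [simp] = K1.polynomial_map_in[OF p1]
  note p2_in [simp] = K2.polynomial_map_in[OF p2]
  note r_in [simp] = K3.polynomial_map_in[OF r]
  define P1 where "P1 = (\<lambda>\<tau> \<sigma>. cinner K1 (p1 \<tau>) (p1 \<sigma>))"
  define P2 where "P2 = (\<lambda>\<tau> \<sigma>. cinner K2 (p2 \<tau>) (p2 \<sigma>))"
  define R where "R = (\<lambda>\<tau> \<sigma>. cinner K3 (r \<tau>) (r \<sigma>))"
  define M where "M = (\<lambda>\<tau> \<sigma>. (P1 \<tau> \<sigma> - P2 \<tau> \<sigma>) / (q \<tau> * cnj (q \<sigma>) - R \<tau> \<sigma>))"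
  have LM: "L \<tau> (vec_cnj \<sigma>) = M \<tau> \<sigma>" if "\<tau> \<in> U" "\<sigma> \<in> U" for \<tau> \<sigma>
    using L[OF that] by (simp add: M_def P1_def P2_def R_def)
  have ne: "q \<tau> * cnj (q \<sigma>) - R \<tau> \<sigma> \<noteq> 0" if "\<tau> \<in> U" "\<sigma> \<in> U" for \<tau> \<sigma>
  proof -
    have "cmod (R \<tau> \<sigma>) \<le> hnorm K3 (r \<tau>) * hnorm K3 (r \<sigma>)"
      unfolding R_def by (rule K3.cinner_bound) simp_all
    also have "\<dots> < cmod (q \<tau>) * cmod (q \<sigma>)"
      by (intro mult_strict_mono' less that K3.hnorm_nonneg r_in)
    also have "\<dots> = cmod (q \<tau> * cnj (q \<sigma>))" by (simp add: norm_mult)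
    finally show ?thesis by auto
  qed

  \<comment> \<open>Stated for two substitutions \<open>f\<close> and \<open>g\<close> so that
    constants and the identity give all four terms of \<open>kernel_dist2\<close>; the inclusions in
    \<open>U\<close> keep the denominator of \<open>M\<close> nonzero.\<close>
  have cont: "continuous_on U (\<lambda>t. P1 (f t) (g t))" "continuous_on U (\<lambda>t. R (f t) (g t))"
    "continuous_on U (\<lambda>t. M (f t) (g t))"
    if "continuous_on U f" "continuous_on U g" "f ` U \<subseteq> U" "g ` U \<subseteq> U" for f g
  proof -
    have q': "continuous_on U (\<lambda>t. q (h t))" if "continuous_on U h" for h
      using continuous_on_compose2[OF continuous_on_polynomial_fun[OF q, of UNIV] that] by simp
    show P1: "continuous_on U (\<lambda>t. P1 (f t) (g t))"
      unfolding P1_def by (rule K1.continuous_on_cinner_polynomial_map[OF p1 that(1,2)])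
    have P2: "continuous_on U (\<lambda>t. P2 (f t) (g t))"
      unfolding P2_def by (rule K2.continuous_on_cinner_polynomial_map[OF p2 that(1,2)])
    show R: "continuous_on U (\<lambda>t. R (f t) (g t))"
      unfolding R_def by (rule K3.continuous_on_cinner_polynomial_map[OF r that(1,2)])
    show "continuous_on U (\<lambda>t. M (f t) (g t))"
      unfolding M_def using that(3,4)
      by (intro continuous_on_divide continuous_on_diff continuous_on_mult continuous_on_cnj q' P1 P2 R that(1,2) ballI ne)
        auto
  qed
  \<comment> \<open>The Gram kernel that the input vectors \<open>x\<close> will have, written down
    before they are constructed; its continuity is what makes the dense pivots approximate
    them.\<close>
  define F where "F = (\<lambda>\<tau> \<sigma>. R \<tau> \<sigma> * M \<tau> \<sigma> + P1 \<tau> \<sigma>)"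
  have cont_dist: "continuous_on U (kernel_dist2 M \<tau>)" "continuous_on U (kernel_dist2 F \<tau>)" if "\<tau> \<in> U" for \<tau>
    unfolding kernel_dist2_def[abs_def] F_def using that
    by (intro continuous_intros cont; force)+

  have "psd_on U M"
    unfolding psd_on_def
  proof (intro conjI ballI allI impI)
    show "M \<tau> \<sigma> = cnj (M \<sigma> \<tau>)" if "\<tau> \<in> U" "\<sigma> \<in> U" for \<tau> \<sigma>
    proof -
      have "L \<tau> (vec_cnj \<sigma>) = cnj (L \<sigma> (vec_cnj \<tau>))"
        using herm that unfolding hermitian_kernel_def by blast
      then show ?thesis by (simp only: LM that)
    qed
    fix n :: nat and t c assume t: "\<forall>k<n. t k \<in> U"
    then have "(\<Sum>k<n. \<Sum>l<n. L (t k) (vec_cnj (t l)) * c k * cnj (c l)) \<in> \<real>\<^sub>\<ge>\<^sub>0"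
      using pos unfolding positive_semidefinite_kernel_def by blast
    then show "0 \<le> Re (\<Sum>k<n. \<Sum>l<n. M (t k) (t l) * c k * cnj (c l))"
      using t by (simp add: LM complex_nonneg_Reals_iff)
  qed
  then obtain k0 :: "complex^'d \<Rightarrow> nat \<Rightarrow> complex" where k0: "\<And>t. t \<in> U \<Longrightarrow> ell2 (k0 t)"
    and ip_k0: "\<And>t u. t \<in> U \<Longrightarrow> u \<in> U \<Longrightarrow> ip (k0 t) (k0 u) = M t u"
    using continuous_kernel_factorization[OF U _ cont_dist(1)] by blast

  \<comment> \<open>Keeping the odd coordinates of the state space free makes room for the isometric extension.\<close>
  define k where "k = (\<lambda>\<tau>. push (\<lambda>n. 2 * n) (k0 \<tau>))"
  have inj2: "inj (\<lambda>n::nat. 2 * n)" by (auto intro: injI)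
  have k: "ell2 (k \<tau>)" if "\<tau> \<in> U" for \<tau> unfolding k_def by (rule ell2_push[OF inj2 k0[OF that]])
  have ip_k: "ip (k \<tau>) (k \<sigma>) = M \<tau> \<sigma>" if "\<tau> \<in> U" "\<sigma> \<in> U" for \<tau> \<sigma>
    unfolding k_def by (simp add: ip_push_left inj2 push_apply ip_k0 that)
  have k_odd: "k \<tau> (Suc (2 * n)) = 0" for \<tau> n
  proof -
    have "Suc (2 * n) \<noteq> 2 * j" for j by presburger
    then show ?thesis unfolding k_def by (intro push_notin) blast
  qed
  have emb_k: "emb (k \<tau>) \<in> carrier (E UNIV)" if "\<tau> \<in> U" for \<tau> using k[OF that] by (simp add: emb_in_iff)

  \<comment> \<open>Both families are set to zero off \<open>U\<close> because
    \<open>lurking_isometry\<close> requires square summability and equal Gram matrices at every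
    index of the type.\<close>
  define x where "x = (\<lambda>\<tau>. if \<tau> \<in> U then case_sum (dec (K3.tens (r \<tau>) (emb (k \<tau>)))) (K1.coord (p1 \<tau>)) else (\<lambda>_. 0))"
  define y where "y = (\<lambda>\<tau>. if \<tau> \<in> U then case_sum (\<lambda>n. q \<tau> * k \<tau> n) (K2.coord (p2 \<tau>)) else (\<lambda>_. 0))"
  have tens_ell2: "ell2 (dec (K3.tens (r \<tau>) (emb (k \<tau>))))" if "\<tau> \<in> U" for \<tau>
    using in_E(2)[OF K3.tens_in[OF emb_k[OF that]]] .
  have x: "ell2 (x \<tau>)" for \<tau> by (simp add: x_def ell2_case_sum tens_ell2 K1.ell2_coord)
  have y: "ell2 (y \<tau>)" for \<tau> by (simp add: y_def ell2_case_sum ell2_scale k K2.ell2_coord)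
  have ip_x: "ip (x \<tau>) (x \<sigma>) = F \<tau> \<sigma>" if "\<tau> \<in> U" "\<sigma> \<in> U" for \<tau> \<sigma>
    using that by (simp add: x_def ip_case_sum tens_ell2 K1.ell2_coord K1.ip_coord K3.ip_tens k ip_k F_def R_def P1_def)
  have ip_y: "ip (y \<tau>) (y \<sigma>) = q \<tau> * cnj (q \<sigma>) * M \<tau> \<sigma> + P2 \<tau> \<sigma>" if "\<tau> \<in> U" "\<sigma> \<in> U" for \<tau> \<sigma>
    using that by (simp add: y_def ip_case_sum ell2_scale k K2.ell2_coord K2.ip_coord ip_scale_left ip_scale_right ip_k P2_def)
  have gram: "ip (x \<tau>) (x \<sigma>) = ip (y \<tau>) (y \<sigma>)" for \<tau> \<sigma>
  proof (cases "\<tau> \<in> U \<and> \<sigma> \<in> U")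
    case True
    then have "M \<tau> \<sigma> * (q \<tau> * cnj (q \<sigma>) - R \<tau> \<sigma>) = P1 \<tau> \<sigma> - P2 \<tau> \<sigma>"
      using ne[of \<tau> \<sigma>] by (simp add: M_def)
    then show ?thesis using True by (simp add: ip_x ip_y F_def algebra_simps)
  next
    case False
    then show ?thesis by (auto simp: x_def y_def ip_def)
  qed
  have "\<exists>s :: nat \<Rightarrow> _. \<forall>\<tau>\<in>U. \<forall>\<epsilon>>0. \<exists>n. kernel_dist2 ip (x \<tau>) (x (s n)) < \<epsilon>"
  proof (cases "U = {}")
    case False
    obtain s :: "nat \<Rightarrow> complex^'d" where s: "\<And>n. s n \<in> U"
      and dense: "\<And>(f :: complex^'d \<Rightarrow> real) t \<epsilon>. continuous_on U f \<Longrightarrow> t \<in> U \<Longrightarrow> f t < \<epsilon> \<Longrightarrow> \<exists>n. f (s n) < \<epsilon>"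
      by (rule dense_sequence[OF U False]) blast
    have "\<exists>n. kernel_dist2 ip (x \<tau>) (x (s n)) < \<epsilon>" if "\<tau> \<in> U" "0 < \<epsilon>" for \<tau> \<epsilon>
    proof -
      have "kernel_dist2 ip (x \<tau>) (x (s n)) = kernel_dist2 F \<tau> (s n)" for n
        by (simp add: kernel_dist2_def ip_x that s)
      then show ?thesis using dense[OF cont_dist(2), of \<tau> \<tau> \<epsilon>] that by simp
    qed
    then show ?thesis by blast
  qed simp
  then obtain s :: "nat \<Rightarrow> complex^'d" where
    s: "\<And>\<tau> \<epsilon>. \<tau> \<in> U \<Longrightarrow> 0 < \<epsilon> \<Longrightarrow> \<exists>n. kernel_dist2 ip (x \<tau>) (x (s n)) < \<epsilon>" by blast

  \<comment> \<open>An input index is folded into \<open>nat\<close> by \<open>sum_encode\<close>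
    and sent to an odd coordinate of the state space, where every \<open>y\<close> vanishes.\<close>
  define z :: "nat + nat \<Rightarrow> nat + nat" where "z = (\<lambda>i. Inl (Suc (2 * sum_encode i)))"
  have z: "inj z" by (auto intro!: injI simp: z_def dest: injD[OF inj_sum_encode[of UNIV]])
  have yz: "y \<tau> (z i) = 0" for \<tau> i by (simp add: y_def z_def k_odd)
  obtain W where W: "\<And>a. ell2 a \<Longrightarrow> ell2 (W a)"
      "\<And>a b. ell2 a \<Longrightarrow> ell2 b \<Longrightarrow> ip (W a) (W b) = ip a b"
    and W_x: "\<And>\<tau>. (\<And>\<epsilon>. 0 < \<epsilon> \<Longrightarrow> \<exists>n. kernel_dist2 ip (x \<tau>) (x (s n)) < \<epsilon>) \<Longrightarrow> W (x \<tau>) = y \<tau>"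
    and W_0: "\<And>a m. (\<And>\<tau>. y \<tau> m = 0) \<Longrightarrow> m \<notin> range z \<Longrightarrow> W a m = 0"
    by (rule lurking_isometry[of x y z s, OF x y gram z yz]) blast
  \<comment> \<open>The range of \<open>z\<close> avoids the right summand, and the coordinates of
    \<open>p2\<close> stop at \<open>m2\<close>, so neither part of \<open>W\<close> reaches these
    entries.\<close>
  have W_supp: "W a (Inr i) = 0" if "m2 \<le> i" for a i
    by (rule W_0) (use that in \<open>auto simp: y_def z_def K2.coord_def\<close>)
  interpret isometric_model emb K1 m1 u1 K2 m2 u2 K3 m3 u3 W
    by unfold_locales (simp_all add: W W_supp)
  interpret HK: complex_hilbert_space K by (rule hilbert_E)

  have col: "isometric_colligation K1 K2 K3 K T K3.tens (E {}) opA opB opC opD"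
    unfolding isometric_colligation_def
    by (simp add: hilbert_E K3.hilbert_tensor E_empty isometric_blocks)
  have inv: "invertible_on K (pencil K K3.tens opA (q \<tau>) (r \<tau>))" if "\<tau> \<in> U" for \<tau>
    by (rule pencil_invertible) (simp_all add: less that)
  have out: "opA (K3.tens (r \<tau>) (emb (k \<tau>))) \<oplus>\<^bsub>K\<^esub> opB (p1 \<tau>) = q \<tau> \<odot>\<^bsub>K\<^esub> emb (k \<tau>)"
    "opC (K3.tens (r \<tau>) (emb (k \<tau>))) \<oplus>\<^bsub>hilbert_sum K2 (E {})\<^esub> opD (p1 \<tau>) = (p2 \<tau>, \<zero>\<^bsub>E {}\<^esub>)"
    if "\<tau> \<in> U" for \<tau>
  proof -
    have "W (case_sum (dec (K3.tens (r \<tau>) (emb (k \<tau>)))) (K1.coord (p1 \<tau>))) =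
        case_sum (\<lambda>n. q \<tau> * k \<tau> n) (K2.coord (p2 \<tau>))"
      using W_x[OF s[OF that]] that by (simp add: x_def y_def)
    with block_out[OF K3.tens_in[OF emb_k[OF that]], of "r \<tau>" "p1 \<tau>"]
    show "opA (K3.tens (r \<tau>) (emb (k \<tau>))) \<oplus>\<^bsub>K\<^esub> opB (p1 \<tau>) = q \<tau> \<odot>\<^bsub>K\<^esub> emb (k \<tau>)"
      "opC (K3.tens (r \<tau>) (emb (k \<tau>))) \<oplus>\<^bsub>hilbert_sum K2 (E {})\<^esub> opD (p1 \<tau>) = (p2 \<tau>, \<zero>\<^bsub>E {}\<^esub>)"
      by (simp_all add: outK_def out2_def E_sel K2.comb_coord)
  qed
  have state: "state_map K K3.tens opA opB q r p1 \<tau> = emb (k \<tau>)" if \<tau>: "\<tau> \<in> U" for \<tau>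
  proof -
    have A: "opA (K3.tens (r \<tau>) (emb (k \<tau>))) \<in> carrier K"
      by (intro outK_in W left_props K3.tens_in emb_k \<tau>)
    have B: "opB (p1 \<tau>) \<in> carrier K" by (intro outK_in W right_props)
    have "pencil K K3.tens opA (q \<tau>) (r \<tau>) (emb (k \<tau>)) = opB (p1 \<tau>)"
      unfolding pencil_def out(1)[OF \<tau>, symmetric]
      by (rule HK.cinner_ext) (use A B in \<open>auto simp: HK.cinner_diff_left HK.cinner_add_left\<close>)
    then show ?thesis
      using inv[OF \<tau>] emb_k[OF \<tau>] unfolding state_map_def invertible_on_def
      by (metis bij_betw_imp_inj_on inv_into_f_f)
  qed
  have real: "realizes_kernel U L K K3.tens opA opB q r p1"
    unfolding realizes_kernel_def by (simp add: inv state LM) (simp add: E_sel ip_k)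
  have "\<forall>\<tau>\<in>U. (p2 \<tau>, \<zero>\<^bsub>E {}\<^esub>) =
      opC (K3.tens (r \<tau>) (state_map K K3.tens opA opB q r p1 \<tau>)) \<oplus>\<^bsub>hilbert_sum K2 (E {})\<^esub> opD (p1 \<tau>)"
    by (simp add: state out(2))
  with col real show ?thesis by blast
qed

text \<open>The formula for \<open>p2\<close> comes with its own existential quantifier because
  \<open>L\<close> depends only on \<open>A\<close> and \<open>B\<close>: composing \<open>C\<close>
  and \<open>D\<close> with a unitary of the enlarged \<open>K2\<close> keeps the realization of
  \<open>L\<close> but changes the right-hand side of that formula.\<close>

theorem proposition5p5:
  fixes U :: "(complex^'d) set"
    and L :: "complex^'d \<Rightarrow> complex^'d \<Rightarrow> complex"
    and K1 :: "'k1 inner_module" and K2 :: "'k2 inner_module" and K3 :: "'k3 inner_module"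
    and p1 :: "complex^'d \<Rightarrow> 'k1" and p2 :: "complex^'d \<Rightarrow> 'k2"
    and q :: "complex^'d \<Rightarrow> complex" and r :: "complex^'d \<Rightarrow> 'k3"
    and emb :: "(nat \<Rightarrow> complex) \<Rightarrow> 'k"
  assumes "open U" and "connected U"
    and "hermitian_kernel U L"
    and "complex_hilbert_space K1" and "finite_dimensional K1"
    and "complex_hilbert_space K2" and "finite_dimensional K2"
    and "complex_hilbert_space K3" and "finite_dimensional K3"
    and "polynomial_map K1 p1" and "polynomial_map K2 p2"
    and "polynomial_fun q" and "polynomial_map K3 r"
    and "\<And>\<tau>. \<tau> \<in> U \<Longrightarrow> cmod (q \<tau>) > hnorm K3 (r \<tau>)"
    and "\<And>\<tau> \<sigma>. \<lbrakk>\<tau> \<in> U; \<sigma> \<in> U\<rbrakk> \<Longrightarrow>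
      L \<tau> (vec_cnj \<sigma>) =
        (cinner K1 (p1 \<tau>) (p1 \<sigma>) - cinner K2 (p2 \<tau>) (p2 \<sigma>)) /
        (q \<tau> * cnj (q \<sigma>) - cinner K3 (r \<tau>) (r \<sigma>))"
    \<comment> \<open>Only a bound on the type over which Hilbert spaces are quantified: it has at least
        continuum many elements, so that all separable Hilbert spaces can be found on it.\<close>
    and "inj emb"
  shows "(positive_semidefinite_kernel U L \<longleftrightarrow>
      (\<exists>(K :: 'k inner_module) (T :: 'k inner_module) tens (E :: 'k inner_module) A B C D.
        isometric_colligation K1 K2 K3 K T tens E A B C D \<and>
        realizes_kernel U L K tens A B q r p1)) \<and>
    (positive_semidefinite_kernel U L \<longrightarrow>
      (\<exists>(K :: 'k inner_module) (T :: 'k inner_module) tens (E :: 'k inner_module) A B C D.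
        isometric_colligation K1 K2 K3 K T tens E A B C D \<and>
        realizes_kernel U L K tens A B q r p1 \<and>
        (\<forall>\<tau>\<in>U. (p2 \<tau>, \<zero>\<^bsub>E\<^esub>) =
          C (tens (r \<tau>) (state_map K tens A B q r p1 \<tau>))
            \<oplus>\<^bsub>hilbert_sum K2 E\<^esub> D (p1 \<tau>))))"
proof (intro conjI iffI impI)
  have realization: "\<exists>(K :: 'k inner_module) (T :: 'k inner_module) tens (E :: 'k inner_module) A B C D.
        isometric_colligation K1 K2 K3 K T tens E A B C D \<and>
        realizes_kernel U L K tens A B q r p1 \<and>
        (\<forall>\<tau>\<in>U. (p2 \<tau>, \<zero>\<^bsub>E\<^esub>) =
          C (tens (r \<tau>) (state_map K tens A B q r p1 \<tau>))
            \<oplus>\<^bsub>hilbert_sum K2 E\<^esub> D (p1 \<tau>))"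
    if "positive_semidefinite_kernel U L"
    by (rule transfer_realization[of U L K1 K2 K3 p1 p2 q r emb]; fact)
  show "\<exists>(K :: 'k inner_module) (T :: 'k inner_module) tens (E :: 'k inner_module) A B C D.
        isometric_colligation K1 K2 K3 K T tens E A B C D \<and>
        realizes_kernel U L K tens A B q r p1"
    if "positive_semidefinite_kernel U L"
    using realization[OF that] by blast
  show "\<exists>(K :: 'k inner_module) (T :: 'k inner_module) tens (E :: 'k inner_module) A B C D.
        isometric_colligation K1 K2 K3 K T tens E A B C D \<and>
        realizes_kernel U L K tens A B q r p1 \<and>
        (\<forall>\<tau>\<in>U. (p2 \<tau>, \<zero>\<^bsub>E\<^esub>) =
          C (tens (r \<tau>) (state_map K tens A B q r p1 \<tau>))
            \<oplus>\<^bsub>hilbert_sum K2 E\<^esub> D (p1 \<tau>))"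
    if "positive_semidefinite_kernel U L"
    by (rule realization[OF that])
next
  assume "\<exists>(K :: 'k inner_module) (T :: 'k inner_module) tens (E :: 'k inner_module) A B C D.
        isometric_colligation K1 K2 K3 K T tens E A B C D \<and>
        realizes_kernel U L K tens A B q r p1"
  then obtain K T :: "'k inner_module" and tens and E :: "'k inner_module" and A B C D
    where "isometric_colligation K1 K2 K3 K T tens E A B C D" "realizes_kernel U L K tens A B q r p1"
    by blast
  moreover obtain m u where "onb_space K1 m u"
    by (rule finite_dimensional_onb_space[OF assms(4,5)])
  then have "p1 \<tau> \<in> carrier K1" for \<tau>
    using onb_space.polynomial_map_in assms(10) by blast
  ultimately show "positive_semidefinite_kernel U L" by (rule realized_kernel_positive)
qed

end
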